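(* Let $S_n=(\mathcal{V},(m_i)_{0\le i\le n-1})$ be a locally finite weighted oriented $n$-simplicial complex and let $\Lambda\subset\mathcal{V}$ be an infinite subset. Decompose the simplices of $S_n$ into interior simplices (all vertices in $\Lambda$), exterior simplices (all vertices in $\mathcal{V}\setminus\Lambda$) and interface simplices (at least one vertex in each), and let $\mathcal{H}=\mathcal{H}_{\mathrm{in}}\oplus\mathcal{H}_{\mathrm{int}}\oplus\mathcal{H}_{\mathrm{out}}$ be the corresponding decomposition, where $\mathcal{H}_{\mathrm{in}}$, $\mathcal{H}_{\mathrm{int}}$, $\mathcal{H}_{\mathrm{out}}$ consist of the (square-summable) cochains of all degrees $0\le i\le n-1$ supported on interior, interface and exterior simplices respectively. Let $D_{\mathrm{in}}$ and $D_{\mathrm{out}}$ be the Gauss--Bonnet operators of the restricted complexes $S_n|_{\Lambda}$ and $S_n|_{\mathcal{V}\setminus\Lambda}$, acting within $\mathcal{H}_{\mathrm{in}}$ and $\mathcal{H}_{\mathrm{out}}$, with domains $\bigoplus_iC_c^i(\Lambda)$ and $\bigoplus_iC_c^i(\mathcal{V}\setminus\Lambda)$. Let $D_0$ be the operator on $\bigoplus_{i=0}^{n-1}C_c^i(\mathcal{V})$ acting as $D_{\mathrm{in}}\oplus D_{\mathrm{out}}$ on the $\mathcal{H}_{\mathrm{in}}\oplus\mathcal{H}_{\mathrm{out}}$ components and as zero on the $\mathcal{H}_{\mathrm{int}}$ component, and let $\overline{D}_0$ be its closure. Suppose: (1) $S_n|_{\Lambda}$ is globally $\chi$-complete and its weighted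 degrees satisfy $\sup_\sigma d_{m_i}(\sigma)<\infty$ for every $0\le i\le n-2$ (all computed in the complex $S_n|_{\Lambda}$); (2) $S_n|_{\mathcal{V}\setminus\Lambda}$ is locally finite, and $D_{\mathrm{out}}$ is essentially self-adjoint on $\bigoplus_{i=0}^{n-1}C_c^i(\mathcal{V}\setminus\Lambda)$; (3) the coupling operator $V:=D-D_0$, defined on $\bigoplus_{i=0}^{n-1}C_c^i(\mathcal{V})$, is symmetric, and there exist constants $a\ge0$ and $0\le b<1$ such that $$\|Vu\|_{\mathcal{H}}\le a\|u\|_{\mathcal{H}}+b\|\overline{D}_0u\|_{\mathcal{H}}\qquad\text{for all }u\in\bigoplus_{i=0}^{n-1}C_c^i(\mathcal{V}).$$ Then $D=d+\delta$ is essentially self-adjoint on $\bigoplus_{i=0}^{n-1}C_c^i(\mathcal{V})$.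
   Context: Complex. $\mathcal{V}$ is a countable set, $m_0:\mathcal{V}\to(0,\infty)$, and $m_1:\mathcal{V}\times\mathcal{V}\to[0,\infty)$ is symmetric with $m_1(x,x)=0$. Write $x\sim y$ (neighbours) if $m_1(x,y)>0$. Locally finite means every vertex has finitely many neighbours. Fix an integer $n\ge2$. For $0\le i\le n-1$, $\mathcal{F}_i$ is the set of ordered tuples $(x_0,\dots,x_i)$ of pairwise adjacent vertices (cliques); these are the $i$-simplices. $P_i$ is the quotient of $\mathcal{F}_i$ by even permutations; $-\tau$ denotes the opposite orientation of $\tau\in P_i$. The weights $m_i:\mathcal{V}^{i+1}\to[0,\infty)$, $0\le i\le n-1$, are invariant under all permutations and positive exactly on $\mathcal{F}_i$. $S_n=(\mathcal{V},(m_i)_{0\le i\le n-1})$ is the weighted oriented $n$-simplicial complex (simplices have at most $n$ vertices). For $1\le i\le n-1$ and an $(i-1)$-simplex, $F(x_0,\dots,x_{i-1})$ is the set of common neighbours of $x_0,\dots,x_{i-1}$, and the weighted degree is $$d_{m_{i-1}}(x_0,\dots,x_{i-1})=\frac1{m_{i-1}(x_0,\dots,x_{i-1})}\sum_{x_i\in F(x_0,\dots,x_{i-1})}m_i(x_0,\dots,x_i).$$ Restriction. For $\Lambda\subset\mathcal{V}$, the restricted complex $S_n|_\Lambda$ has vertex set $\Lambda$, its simplices are the simplices of $S_n$ with all vertices in $\Lambda$, and its weights are the restrictions of the $m_i$; all notions (cochains, $d$, $\delta$, weighted degree, energy) are then formed within $S_n|_\Lambda$. Cochains. $C_c^i(\mathcal{V})$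 is the space of finitely supported $f:P_i\to\mathbb{C}$ with $f(-\tau)=-f(\tau)$ (alternating functions on $\mathcal{F}_i$), with inner product $\langle f,g\rangle_{\ell^2(m_i)}=\frac1{(i+1)!}\sum_{(x_0,\dots,x_i)\in\mathcal{F}_i}m_i(x_0,\dots,x_i)\overline{f(x_0,\dots,x_i)}g(x_0,\dots,x_i)$; $\ell^2(m_i)$ is its completion and $\mathcal{H}=\bigoplus_{i=0}^{n-1}\ell^2(m_i)$. Operators. For $0\le i\le n-2$, $d_if(x_0,\dots,x_{i+1})=\sum_{j=0}^{i+1}(-1)^jf(x_0,\dots,\widehat{x_j},\dots,x_{i+1})$. For $1\le i\le n-1$, $$\delta_ig(x_0,\dots,x_{i-1})=\frac{(-1)^i}{m_{i-1}(x_0,\dots,x_{i-1})}\sum_{x_i\in F(x_0,\dots,x_{i-1})}m_i(x_0,\dots,x_i)g(x_0,\dots,x_i).$$ The Gauss--Bonnet operator $D=d+\delta$ acts on $F=(f_0,\dots,f_{n-1})\in\bigoplus_iC_c^i(\mathcal{V})$ by $(DF)_i=d_{i-1}f_{i-1}+\delta_{i+1}f_{i+1}$, where terms with index out of range are $0$. $\chi$-completeness. $O_k\nearrow\mathcal{V}$ means the $O_k$ increase with union $\mathcal{V}$. For $\chi:\mathcal{V}\to[0,1]$ and $1\le\ell\le n-1$ the energy at level $\ell$ is $$E_\ell(\chi)=\frac1{\ell!}\sum_{(x_0,\dots,x_{\ell-1})\in P_{\ell-1}^+}\frac1{m_{\ell-1}(x_0,\dots,x_{\ell-1})}\sum_{x_\ell\in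 F(x_0,\dots,x_{\ell-1})}m_\ell(x_0,\dots,x_\ell)\sum_{j=0}^\ell|a_j|^2,$$ where $P_{\ell-1}^+$ contains exactly one orientation of each $(\ell-1)$-simplex and $a_j=\frac{S-(\ell+1)\chi(x_j)}{\ell(\ell+1)}$, $S=\sum_{k=0}^\ell\chi(x_k)$. A complex $S_n$ with vertex set $\mathcal{V}$ is globally $\chi$-complete if there are finite sets $O_k\nearrow\mathcal{V}$ ($k\in\mathbb{N}$), functions $\chi_k:\mathcal{V}\to[0,1]$ and a constant $C>0$ such that for all $k$ and all $1\le\ell\le n-1$: $\chi_k$ has finite support, $\chi_k=1$ on $O_k$, and $E_\ell(\chi_k)\le C$. For $S_n|_\Lambda$ this is applied with vertex set $\Lambda$. *)

theory Defs
  imports "HOL-Analysis.Analysis" "HOL-Combinatorics.Combinatorics"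
begin

section \<open>Weighted oriented simplicial complexes\<close>

text \<open>
  A tuple $(x_0,\dots,x_i)$ of vertices is a list of length $i+1$, and the weights
  $m_0,\dots,m_{n-1}$ are bundled into one function on lists: $m_i$ is \<open>weight\<close> on lists of
  length $i+1$. The field \<open>max_vertices\<close> is the integer $n$. Only the values of \<open>weight\<close> on
  lists over \<open>vertices\<close> with at least one and at most $n$ entries are meaningful.
\<close>

record 'v weighted_complex =
  vertices :: "'v set"
  max_vertices :: nat
  weight :: "'v list \<Rightarrow> real"

definition adjacent :: "'v weighted_complex \<Rightarrow> 'v \<Rightarrow> 'v \<Rightarrow> bool" where
  "adjacent S x y \<longleftrightarrow> x \<in> vertices S \<and> y \<in> vertices S \<and> weight S [x, y] > 0"

definition simplices :: "'v weighted_complex \<Rightarrow> nat \<Rightarrow> 'v list set" where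
  "simplices S i = {xs. length xs = i + 1 \<and> set xs \<subseteq> vertices S \<and>
     (\<forall>j<length xs. \<forall>k<length xs. j \<noteq> k \<longrightarrow> adjacent S (xs ! j) (xs ! k))}"

definition all_simplices :: "'v weighted_complex \<Rightarrow> 'v list set" where
  "all_simplices S = (\<Union>i<max_vertices S. simplices S i)"

definition is_weighted_complex :: "'v weighted_complex \<Rightarrow> bool" where
  "is_weighted_complex S \<longleftrightarrow>
     countable (vertices S) \<and>
     max_vertices S \<ge> 2 \<and>
     (\<forall>x\<in>vertices S. weight S [x] > 0) \<and>
     (\<forall>x\<in>vertices S. weight S [x, x] = 0) \<and>
     (\<forall>i<max_vertices S. \<forall>xs. length xs = i + 1 \<and> set xs \<subseteq> vertices S \<longrightarrow>
        weight S xs \<ge> 0 \<and>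
        (weight S xs > 0 \<longleftrightarrow> xs \<in> simplices S i) \<and>
        (\<forall>p. p permutes {..<length xs} \<longrightarrow> weight S (permute_list p xs) = weight S xs))"

definition locally_finite_complex :: "'v weighted_complex \<Rightarrow> bool" where
  "locally_finite_complex S \<longleftrightarrow> (\<forall>x\<in>vertices S. finite {y \<in> vertices S. adjacent S x y})"

definition common_neighbours :: "'v weighted_complex \<Rightarrow> 'v list \<Rightarrow> 'v set" where
  "common_neighbours S xs = {y \<in> vertices S. \<forall>x\<in>set xs. adjacent S x y}"

text \<open>
  \<open>common_neighbours S xs\<close> is finite for every simplex of a locally finite complex, so the finite
  sums over it here and in \<open>delta_op\<close> are genuine.
\<close>

definition weighted_degree :: "'v weighted_complex \<Rightarrow> 'v list \<Rightarrow> real" where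
  "weighted_degree S xs =
     (1 / weight S xs) * (\<Sum>x\<in>common_neighbours S xs. weight S (xs @ [x]))"

text \<open>All notions read the weights only on tuples over \<open>vertices\<close>, hence replacing the vertex
  set also restricts the simplices and the weights.\<close>

definition restrict_complex :: "'v weighted_complex \<Rightarrow> 'v set \<Rightarrow> 'v weighted_complex" where
  "restrict_complex S \<Lambda> = S\<lparr>vertices := \<Lambda>\<rparr>"

definition interior_simplices :: "'v weighted_complex \<Rightarrow> 'v set \<Rightarrow> 'v list set" where
  "interior_simplices S \<Lambda> = {xs \<in> all_simplices S. set xs \<subseteq> \<Lambda>}"

definition exterior_simplices :: "'v weighted_complex \<Rightarrow> 'v set \<Rightarrow> 'v list set" where
  "exterior_simplices S \<Lambda> = {xs \<in> all_simplices S. set xs \<subseteq> vertices S - \<Lambda>}"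

definition interface_simplices :: "'v weighted_complex \<Rightarrow> 'v set \<Rightarrow> 'v list set" where
  "interface_simplices S \<Lambda> =
     {xs \<in> all_simplices S. set xs \<inter> \<Lambda> \<noteq> {} \<and> set xs \<inter> (vertices S - \<Lambda>) \<noteq> {}}"

section \<open>Cochains\<close>

text \<open>
  A family $(f_0,\dots,f_{n-1})$ of cochains is one function on lists: $f_i$ is its restriction to
  lists of length $i+1$. Cochains vanish off the simplices, so cochains of a restricted complex
  are cochains of the whole complex (extended by zero).
\<close>

type_synonym 'v cochain = "'v list \<Rightarrow> complex"

definition cochains :: "'v weighted_complex \<Rightarrow> 'v cochain set" where
  "cochains S = {f. (\<forall>xs. xs \<notin> all_simplices S \<longrightarrow> f xs = 0) \<and>
     (\<forall>xs\<in>all_simplices S. \<forall>p. p permutes {..<length xs} \<longrightarrow>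
        f (permute_list p xs) = of_int (sign p) * f xs)}"

definition fin_cochains :: "'v weighted_complex \<Rightarrow> 'v cochain set" where
  "fin_cochains S = {f \<in> cochains S. finite {xs. f xs \<noteq> 0}}"

definition l2_cochains :: "'v weighted_complex \<Rightarrow> 'v cochain set" where
  "l2_cochains S = {f \<in> cochains S. \<forall>i<max_vertices S.
     (\<lambda>xs. weight S xs * (cmod (f xs))\<^sup>2) summable_on simplices S i}"

definition l2_inner :: "'v weighted_complex \<Rightarrow> 'v cochain \<Rightarrow> 'v cochain \<Rightarrow> complex" where
  "l2_inner S f g = (\<Sum>i<max_vertices S. (1 / fact (i + 1)) *
     (\<Sum>\<^sub>\<infinity>xs\<in>simplices S i. of_real (weight S xs) * cnj (f xs) * g xs))"

definition l2_norm :: "'v weighted_complex \<Rightarrow> 'v cochain \<Rightarrow> real" where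
  "l2_norm S f = sqrt (Re (l2_inner S f f))"

definition component :: "'v list set \<Rightarrow> 'v cochain \<Rightarrow> 'v cochain" where
  "component A f = (\<lambda>xs. if xs \<in> A then f xs else 0)"

section \<open>The Gauss--Bonnet operator\<close>

definition d_op :: "'v weighted_complex \<Rightarrow> 'v cochain \<Rightarrow> 'v cochain" where
  "d_op S f = (\<lambda>xs. if xs \<in> all_simplices S \<and> length xs \<ge> 2
     then \<Sum>j<length xs. (-1) ^ j * f (take j xs @ drop (Suc j) xs) else 0)"

definition delta_op :: "'v weighted_complex \<Rightarrow> 'v cochain \<Rightarrow> 'v cochain" where
  "delta_op S g = (\<lambda>xs. if xs \<in> all_simplices S \<and> length xs < max_vertices S
     then (-1) ^ length xs / of_real (weight S xs) *
       (\<Sum>x\<in>common_neighbours S xs. of_real (weight S (xs @ [x])) * g (xs @ [x])) else 0)"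

definition gauss_bonnet :: "'v weighted_complex \<Rightarrow> 'v cochain \<Rightarrow> 'v cochain" where
  "gauss_bonnet S f = (\<lambda>xs. d_op S f xs + delta_op S f xs)"

definition decoupled :: "'v weighted_complex \<Rightarrow> 'v set \<Rightarrow> 'v cochain \<Rightarrow> 'v cochain" where
  "decoupled S \<Lambda> f = (\<lambda>xs.
     gauss_bonnet (restrict_complex S \<Lambda>) (component (interior_simplices S \<Lambda>) f) xs
     + gauss_bonnet (restrict_complex S (vertices S - \<Lambda>))
         (component (exterior_simplices S \<Lambda>) f) xs
     + 0 * component (interface_simplices S \<Lambda>) f xs)"

definition coupling :: "'v weighted_complex \<Rightarrow> 'v set \<Rightarrow> 'v cochain \<Rightarrow> 'v cochain" where
  "coupling S \<Lambda> f = (\<lambda>xs. gauss_bonnet S f xs - decoupled S \<Lambda> f xs)"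

section \<open>Unbounded operators in the space of square-summable cochains\<close>

text \<open>An unbounded operator is identified with its graph.\<close>

type_synonym 'v operator = "('v cochain \<times> 'v cochain) set"

definition operator_on :: "'v cochain set \<Rightarrow> ('v cochain \<Rightarrow> 'v cochain) \<Rightarrow> 'v operator" where
  "operator_on A T = {(u, T u) | u. u \<in> A}"

definition op_apply :: "'v operator \<Rightarrow> 'v cochain \<Rightarrow> 'v cochain" where
  "op_apply T u = (THE v. (u, v) \<in> T)"

definition densely_defined :: "'v weighted_complex \<Rightarrow> 'v operator \<Rightarrow> bool" where
  "densely_defined S T \<longleftrightarrow>
     (\<forall>g\<in>l2_cochains S. \<forall>\<epsilon>>0. \<exists>u\<in>Domain T. l2_norm S (\<lambda>xs. g xs - u xs) < \<epsilon>)"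

definition op_closure :: "'v weighted_complex \<Rightarrow> 'v operator \<Rightarrow> 'v operator" where
  "op_closure S T = {(u, v). u \<in> l2_cochains S \<and> v \<in> l2_cochains S \<and>
     (\<exists>p q. (\<forall>k::nat. (p k, q k) \<in> T) \<and>
        (\<lambda>k. l2_norm S (\<lambda>xs. p k xs - u xs)) \<longlonglongrightarrow> 0 \<and>
        (\<lambda>k. l2_norm S (\<lambda>xs. q k xs - v xs)) \<longlonglongrightarrow> 0)}"

definition op_adjoint :: "'v weighted_complex \<Rightarrow> 'v operator \<Rightarrow> 'v operator" where
  "op_adjoint S T = {(g, h). g \<in> l2_cochains S \<and> h \<in> l2_cochains S \<and>
     (\<forall>(u, v)\<in>T. l2_inner S g v = l2_inner S h u)}"

definition symmetric_op :: "'v weighted_complex \<Rightarrow> 'v operator \<Rightarrow> bool" where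
  "symmetric_op S T \<longleftrightarrow> T \<subseteq> l2_cochains S \<times> l2_cochains S \<and> densely_defined S T \<and>
     (\<forall>(u, v)\<in>T. \<forall>(u', v')\<in>T. l2_inner S v u' = l2_inner S u v')"

definition self_adjoint :: "'v weighted_complex \<Rightarrow> 'v operator \<Rightarrow> bool" where
  "self_adjoint S T \<longleftrightarrow> densely_defined S T \<and> op_adjoint S T = T"

definition essentially_self_adjoint :: "'v weighted_complex \<Rightarrow> 'v operator \<Rightarrow> bool" where
  "essentially_self_adjoint S T \<longleftrightarrow> symmetric_op S T \<and> self_adjoint S (op_closure S T)"

section \<open>Global chi-completeness\<close>

text \<open>
  One listing of each set of vertices spanning an $i$-simplex, that is, one orientation of each
  $i$-simplex together with a tuple representing it. The summand of the energy is invariant under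
  permutations of the tuple, so the choice is immaterial.
\<close>

definition positive_simplices :: "'v weighted_complex \<Rightarrow> nat \<Rightarrow> 'v list set" where
  "positive_simplices S i =
     (\<lambda>\<sigma>. SOME xs. xs \<in> simplices S i \<and> set xs = \<sigma>) ` (set ` simplices S i)"

definition energy_coeff :: "('v \<Rightarrow> real) \<Rightarrow> nat \<Rightarrow> 'v list \<Rightarrow> nat \<Rightarrow> real" where
  "energy_coeff chi l ys j =
     ((\<Sum>k\<le>l. chi (ys ! k)) - (real l + 1) * chi (ys ! j)) / (real l * (real l + 1))"

text \<open>The energy is a sum of nonnegative terms with values in $[0,\infty]$.\<close>

definition energy :: "'v weighted_complex \<Rightarrow> nat \<Rightarrow> ('v \<Rightarrow> real) \<Rightarrow> ennreal" where
  "energy S l chi = ennreal (1 / fact l) *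
     (\<Sum>\<^sub>\<infinity>xs\<in>positive_simplices S (l - 1). ennreal (1 / weight S xs) *
        (\<Sum>\<^sub>\<infinity>x\<in>common_neighbours S xs. ennreal (weight S (xs @ [x]) *
           (\<Sum>j\<le>l. \<bar>energy_coeff chi l (xs @ [x]) j\<bar>\<^sup>2))))"

definition chi_complete :: "'v weighted_complex \<Rightarrow> bool" where
  "chi_complete S \<longleftrightarrow> (\<exists>(Ov :: nat \<Rightarrow> 'v set) (chi :: nat \<Rightarrow> 'v \<Rightarrow> real) (B :: real).
     B > 0 \<and> incseq Ov \<and> (\<Union>k. Ov k) = vertices S \<and>
     (\<forall>k. finite (Ov k) \<and>
        (\<forall>x\<in>vertices S. 0 \<le> chi k x \<and> chi k x \<le> 1) \<and>
        finite {x \<in> vertices S. chi k x \<noteq> 0} \<and>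
        (\<forall>x\<in>Ov k. chi k x = 1) \<and>
        (\<forall>l. 1 \<le> l \<and> l \<le> max_vertices S - 1 \<longrightarrow> energy S l (chi k) \<le> ennreal B)))"

end

theory Submission
  imports Defs "HOL-Library.Function_Algebras"
begin

text \<open>
  The essential point is that bounded weighted degrees make the interior Gauss--Bonnet operator
  \<open>D_in\<close> bounded. By the Cauchy--Schwarz inequality, applied to the sum over the common
  neighbours of a simplex, the norm of \<open>\<delta>\<close> is controlled by the degrees
  (\<open>l2_norm_delta_op_le\<close>), and \<open>d\<close> inherits the bound because it is the adjoint of \<open>\<delta>\<close>
  (\<open>gauss_bonnet_bounded\<close>). Let \<open>T_out\<close> be \<open>D_out\<close> extended by zero to interior and interface
  cochains. Then \<open>D = T_out + (V + D_in)\<close>, and with \<open>K\<close> a bound for \<open>D_in\<close> the perturbation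
  satisfies
  \[ \|(V + D_{in})u\| \le (a + K + bK)\,\|u\| + b\,\|T_{out}u\|, \qquad b < 1. \]
  The assumed bound on \<open>V\<close> enters on the domain of \<open>D_0\<close>, where the closure of \<open>D_0\<close> acts as \<open>D_0\<close>
  (\<open>op_apply_op_closure\<close>). So the relative bound is still \<open>b\<close>, and the claim is an instance of the Kato--Rellich theorem.

  All spectral theory is reduced to one criterion: a symmetric operator \<open>T\<close> is essentially
  self-adjoint as soon as \<open>T + i\<mu>\<close> and \<open>T - i\<mu>\<close> have dense range for one \<open>\<mu> > 0\<close>
  (\<open>adjoint_in_closure_if_dense_range\<close>). Conversely, essential self-adjointness gives dense range for
  every real \<open>\<mu> \<noteq> 0\<close> (\<open>dense_range_shifted\<close>). For \<open>T_out\<close>, dense range is inherited from \<open>D_out\<close> on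
  exterior cochains, while on interior and interface cochains \<open>T_out + i\<mu>\<close> is multiplication by
  \<open>i\<mu>\<close> (\<open>dense_range_shifted_compressed\<close>). For large \<open>\<mu>\<close> the perturbation is a strict contraction
  relative to \<open>T_out + i\<mu>\<close>, so it preserves dense range (\<open>Kato_Rellich\<close>).

  On the combinatorial side three facts about a locally finite complex are needed: \<open>d\<close> and \<open>\<delta>\<close> map
  finitely supported cochains to such cochains, they are formal adjoints of each other, and
  square-summable cochains form a Hilbert space in which the finitely supported ones are dense. The
  signs in the first two are controlled by one description of alternating functions: they change sign
  under swaps of adjacent entries (\<open>cochains_iff\<close>).
\<close>

section \<open>Symmetric operators in a complex Hilbert space\<close>

lemma tendsto_0_if_le:
  fixes f e :: "nat \<Rightarrow> real"
  assumes "\<And>k. 0 \<le> f k" "\<And>k. f k \<le> e k" "e \<longlonglongrightarrow> 0"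
  shows "f \<longlonglongrightarrow> 0"
  using assms by (intro tendsto_sandwich[OF _ _ tendsto_const assms(3)]) auto

lemma inverse_Suc_tendsto_0: "(\<lambda>k. 1 / real (Suc k)) \<longlonglongrightarrow> 0"
  using LIMSEQ_inverse_real_of_nat by (simp add: inverse_eq_divide)

text \<open>
  The Hilbert space is a complete subspace \<open>H\<close> of an ambient vector space, because the cochains in
  question are a set and not a type; the inner product is constrained on \<open>H\<close> only, because the sum
  that defines it need not converge elsewhere. The norm is a parameter so that
  \<open>l2_norm\<close> itself can be used in instances.
\<close>

locale complex_hilbert_space = vector_space scale
  for scale :: "complex \<Rightarrow> 'h::ab_group_add \<Rightarrow> 'h" (infixr "*C" 75) +
  fixes H :: "'h set" and ip :: "'h \<Rightarrow> 'h \<Rightarrow> complex" and nrm :: "'h \<Rightarrow> real"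
  assumes subspace_H: "subspace H"
    and ip_add_right: "\<lbrakk>f \<in> H; g \<in> H; h \<in> H\<rbrakk> \<Longrightarrow> ip f (g + h) = ip f g + ip f h"
    and ip_scale_right: "\<lbrakk>f \<in> H; g \<in> H\<rbrakk> \<Longrightarrow> ip f (c *C g) = c * ip f g"
    and ip_commute: "\<lbrakk>f \<in> H; g \<in> H\<rbrakk> \<Longrightarrow> ip f g = cnj (ip g f)"
    and ip_nonneg: "f \<in> H \<Longrightarrow> 0 \<le> Re (ip f f)"
    and ip_definite: "\<lbrakk>f \<in> H; ip f f = 0\<rbrakk> \<Longrightarrow> f = 0"
    and nrm_eq: "nrm f = sqrt (Re (ip f f))"
    and complete: "\<lbrakk>\<And>k::nat. p k \<in> H; \<And>\<epsilon>. \<epsilon> > 0 \<Longrightarrow> \<exists>N. \<forall>k\<ge>N. \<forall>l\<ge>N. nrm (p k - p l) < \<epsilon>\<rbrakk>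
      \<Longrightarrow> \<exists>u\<in>H. (\<lambda>k. nrm (p k - u)) \<longlonglongrightarrow> 0"
begin

lemma H_closed [simp, intro]:
  "0 \<in> H"
  "\<lbrakk>f \<in> H; g \<in> H\<rbrakk> \<Longrightarrow> f + g \<in> H"
  "\<lbrakk>f \<in> H; g \<in> H\<rbrakk> \<Longrightarrow> f - g \<in> H"
  "f \<in> H \<Longrightarrow> c *C f \<in> H"
  using subspace_H subspace_0 subspace_add subspace_diff subspace_scale by blast+

lemma ip_add_left: "\<lbrakk>f \<in> H; g \<in> H; h \<in> H\<rbrakk> \<Longrightarrow> ip (f + g) h = ip f h + ip g h"
  by (subst (1 2 3) ip_commute) (auto simp: ip_add_right)

lemma ip_scale_left: "\<lbrakk>f \<in> H; g \<in> H\<rbrakk> \<Longrightarrow> ip (c *C f) g = cnj c * ip f g"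
  by (subst (1 2) ip_commute) (auto simp: ip_scale_right)

lemma ip_diff_right: "\<lbrakk>f \<in> H; g \<in> H; h \<in> H\<rbrakk> \<Longrightarrow> ip f (g - h) = ip f g - ip f h"
  using ip_add_right[of f "g - h" h] by simp

lemma ip_diff_left: "\<lbrakk>f \<in> H; g \<in> H; h \<in> H\<rbrakk> \<Longrightarrow> ip (f - g) h = ip f h - ip g h"
  using ip_add_left[of "f - g" g h] by simp

lemmas ip_linear = ip_add_left ip_add_right ip_diff_left ip_diff_right ip_scale_left ip_scale_right

lemma ip_zero [simp]: "f \<in> H \<Longrightarrow> ip f 0 = 0" "f \<in> H \<Longrightarrow> ip 0 f = 0"
  using ip_diff_right[of f 0 0] ip_diff_left[of 0 0 f] by auto

lemma nrm_ge_0 [simp]: "f \<in> H \<Longrightarrow> 0 \<le> nrm f"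
  by (simp add: nrm_eq ip_nonneg)

lemma nrm_zero [simp]: "nrm 0 = 0"
  by (simp add: nrm_eq)

lemma nrm_sq: "f \<in> H \<Longrightarrow> (nrm f)\<^sup>2 = Re (ip f f)"
  by (simp add: nrm_eq ip_nonneg)

lemma ip_self: "f \<in> H \<Longrightarrow> ip f f = of_real ((nrm f)\<^sup>2)"
proof -
  assume "f \<in> H"
  then have "Im (ip f f) = 0" using ip_commute[of f f] by (metis Reals_cnj_iff complex_is_Real_iff)
  then show ?thesis using \<open>f \<in> H\<close> by (simp add: complex_eq_iff nrm_sq)
qed

lemma nrm_eq_0D: "\<lbrakk>f \<in> H; nrm f = 0\<rbrakk> \<Longrightarrow> f = 0"
  using ip_definite ip_self by simp

lemma nrm_scale [simp]: "f \<in> H \<Longrightarrow> nrm (c *C f) = cmod c * nrm f"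
proof -
  assume f: "f \<in> H"
  have "(nrm (c *C f))\<^sup>2 = Re (c * cnj c * ip f f)"
    using f by (simp add: nrm_sq ip_linear mult_ac)
  also have "c * cnj c * ip f f = of_real ((cmod c * nrm f)\<^sup>2)"
    using f by (simp add: complex_mult_cnj cmod_power2 ip_self power_mult_distrib)
  finally have "(nrm (c *C f))\<^sup>2 = (cmod c * nrm f)\<^sup>2" by simp
  then show ?thesis using f by (simp add: power2_eq_iff_nonneg)
qed

lemma nrm_diff_commute: "\<lbrakk>f \<in> H; g \<in> H\<rbrakk> \<Longrightarrow> nrm (f - g) = nrm (g - f)"
  using nrm_scale[of "g - f" "-1"] by simp

lemma nrm_add_sq:
  "\<lbrakk>f \<in> H; g \<in> H\<rbrakk> \<Longrightarrow> (nrm (f + g))\<^sup>2 = (nrm f)\<^sup>2 + (nrm g)\<^sup>2 + 2 * Re (ip f g)"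
  using ip_commute[of f g] by (simp add: nrm_sq ip_linear)

lemma nrm_diff_sq:
  "\<lbrakk>f \<in> H; g \<in> H\<rbrakk> \<Longrightarrow> (nrm (f - g))\<^sup>2 = (nrm f)\<^sup>2 + (nrm g)\<^sup>2 - 2 * Re (ip f g)"
  using ip_commute[of f g] by (simp add: nrm_sq ip_linear)

text \<open>
  Subtracting the projection of \<open>r\<close> to the line of \<open>m\<close> shortens \<open>r\<close> unless the two are
  orthogonal already. This one computation yields the Cauchy--Schwarz inequality and, below, the
  orthogonality of a nearest-point residue.
\<close>

lemma nrm_diff_projection:
  assumes "r \<in> H" "m \<in> H" "m \<noteq> 0"
  shows "(nrm (r - (ip m r / ip m m) *C m))\<^sup>2 = (nrm r)\<^sup>2 - (cmod (ip m r))\<^sup>2 / (nrm m)\<^sup>2"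
proof -
  have "nrm m \<noteq> 0" using assms nrm_eq_0D by blast
  have mm: "ip m m = of_real ((nrm m)\<^sup>2)" using ip_self assms by blast
  have "ip r m = cnj (ip m r)" using ip_commute assms by blast
  then have "ip r ((ip m r / ip m m) *C m) = of_real ((cmod (ip m r))\<^sup>2 / (nrm m)\<^sup>2)"
    unfolding mm using assms
    by (simp add: ip_scale_right complex_norm_square del: of_real_power)
  moreover have "(nrm ((ip m r / ip m m) *C m))\<^sup>2 = (cmod (ip m r))\<^sup>2 / (nrm m)\<^sup>2"
    unfolding mm using assms \<open>nrm m \<noteq> 0\<close>
    by (simp add: norm_divide power_mult_distrib power_divide norm_power) (simp add: power2_eq_square power4_eq_xxxx)
  ultimately show ?thesis using assms by (simp add: nrm_diff_sq)
qed

lemma Cauchy_Schwarz: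
  assumes "f \<in> H" "g \<in> H"
  shows "cmod (ip f g) \<le> nrm f * nrm g"
proof (cases "f = 0")
  case False
  then have "nrm f > 0" using assms nrm_eq_0D nrm_ge_0 by (metis less_eq_real_def)
  have "0 \<le> (nrm g)\<^sup>2 - (cmod (ip f g))\<^sup>2 / (nrm f)\<^sup>2"
    using nrm_diff_projection[OF assms(2,1) False] by (metis zero_le_power2)
  then have "(cmod (ip f g))\<^sup>2 \<le> (nrm f * nrm g)\<^sup>2"
    using \<open>nrm f > 0\<close> by (simp add: field_simps power_mult_distrib)
  then show ?thesis using assms by (simp add: power2_le_iff_abs_le)
qed (use assms in auto)

lemma nrm_triangle: "\<lbrakk>f \<in> H; g \<in> H\<rbrakk> \<Longrightarrow> nrm (f + g) \<le> nrm f + nrm g"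
proof (rule power2_le_imp_le)
  assume fg: "f \<in> H" "g \<in> H"
  have "Re (ip f g) \<le> nrm f * nrm g"
    using Cauchy_Schwarz[OF fg] complex_Re_le_cmod order_trans by blast
  then show "(nrm (f + g))\<^sup>2 \<le> (nrm f + nrm g)\<^sup>2"
    using fg by (simp add: nrm_add_sq power2_sum)
qed auto

lemma nrm_triangle_diff:
  "\<lbrakk>f \<in> H; g \<in> H; h \<in> H\<rbrakk> \<Longrightarrow> nrm (f - h) \<le> nrm (f - g) + nrm (g - h)"
  using nrm_triangle[of "f - g" "g - h"] by simp

lemma ip_tendsto:
  assumes "\<And>k. p k \<in> H" "\<And>k. q k \<in> H" "u \<in> H" "v \<in> H"
    and "(\<lambda>k::nat. nrm (p k - u)) \<longlonglongrightarrow> 0" "(\<lambda>k. nrm (q k - v)) \<longlonglongrightarrow> 0"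
  shows "(\<lambda>k. ip (p k) (q k)) \<longlonglongrightarrow> ip u v"
proof -
  let ?e = "\<lambda>k. nrm (p k - u) * nrm (q k - v) + nrm (p k - u) * nrm v + nrm u * nrm (q k - v)"
  have "cmod (ip (p k) (q k) - ip u v) \<le> ?e k" for k
  proof -
    have "ip (p k) (q k) - ip u v = ip (p k - u) (q k - v) + ip (p k - u) v + ip u (q k - v)"
      using assms by (simp add: ip_linear)
    also have "cmod \<dots> \<le> ?e k"
      by (intro norm_triangle_le add_mono Cauchy_Schwarz) (use assms in auto)
    finally show ?thesis .
  qed
  moreover have "?e \<longlonglongrightarrow> 0" using assms(5,6) by (auto intro!: tendsto_eq_intros)
  ultimately have "(\<lambda>k. ip (p k) (q k) - ip u v) \<longlonglongrightarrow> 0"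
    by (metis (no_types, lifting) Lim_null_comparison eventually_sequentiallyI)
  then show ?thesis by (simp add: LIM_zero_iff)
qed

text \<open>
  If \<open>r\<close> were not orthogonal to \<open>m\<close>, its projection to the line of \<open>m\<close> would be a point of \<open>M\<close>
  strictly nearer to \<open>r\<close> than \<open>0\<close>.
\<close>

lemma orthogonal_if_nearest_0:
  assumes "subspace M" "M \<subseteq> H" "r \<in> H" "\<And>m. m \<in> M \<Longrightarrow> nrm r \<le> nrm (r - m)" "m \<in> M"
  shows "ip r m = 0"
proof (cases "m = 0")
  case False
  have m: "m \<in> H" using assms by auto
  then have "nrm m > 0" using False nrm_eq_0D nrm_ge_0 by (metis less_eq_real_def)
  have "nrm r \<le> nrm (r - (ip m r / ip m m) *C m)"
    using assms subspace_scale by blast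
  then have "(nrm r)\<^sup>2 \<le> (nrm r)\<^sup>2 - (cmod (ip m r))\<^sup>2 / (nrm m)\<^sup>2"
    using nrm_diff_projection[OF assms(3) m False] assms(3) by (metis nrm_ge_0 power_mono)
  then have "ip m r = 0" using \<open>nrm m > 0\<close> by (simp add: divide_le_0_iff)
  then show ?thesis using ip_commute[of r m] assms m by auto
qed (use assms in auto)

text \<open>
  The projection theorem in the form in which it is used here. A sequence in \<open>M\<close> that minimizes the
  distance to \<open>y\<close> converges to some \<open>z\<close>, which need not lie in \<open>M\<close>; the residue \<open>y - z\<close> is
  orthogonal to \<open>M\<close>, hence zero. This is the only place where completeness enters.
\<close>

lemma dense_if_orthogonal_trivial:
  assumes M: "subspace M" "M \<subseteq> H"
    and triv: "\<And>r. \<lbrakk>r \<in> H; \<And>m. m \<in> M \<Longrightarrow> ip r m = 0\<rbrakk> \<Longrightarrow> r = 0"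
    and y: "y \<in> H" and "\<epsilon> > 0"
  shows "\<exists>m\<in>M. nrm (m - y) < \<epsilon>"
proof -
  define d where "d = (INF m\<in>M. nrm (y - m))"
  have 0: "0 \<in> M" using M subspace_0 by blast
  have dist: "y - m \<in> H" if "m \<in> M" for m using that M y by auto
  have d_le: "d \<le> nrm (y - m)" if "m \<in> M" for m
    unfolding d_def by (rule cINF_lower) (use that dist in \<open>auto intro!: bdd_belowI[of _ 0]\<close>)
  have d_ge: "d \<ge> 0"
    unfolding d_def by (rule cINF_greatest) (use 0 dist in auto)
  have d_near: "\<exists>m\<in>M. nrm (y - m) < d + \<delta>" if "\<delta> > 0" for \<delta>
    using cInf_lessD[of "(\<lambda>m. nrm (y - m)) ` M" "d + \<delta>"] 0 that by (auto simp: d_def)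
  have "\<forall>k::nat. \<exists>m. m \<in> M \<and> nrm (y - m) < d + 1 / Suc k"
    using d_near by (meson of_nat_0_less_iff zero_less_Suc zero_less_divide_1_iff)
  then obtain p where p: "\<And>k. p k \<in> M" "\<And>k. nrm (y - p k) < d + 1 / Suc k" by metis
  have pH: "p k \<in> H" for k using p M by auto
  \<comment> \<open>A minimizing sequence is Cauchy, by the parallelogram law.\<close>
  have par: "(nrm (p k - p l))\<^sup>2 \<le> (8 * d + 4) * (1 / Suc N)" if "k \<ge> N" "l \<ge> N" for k l N
  proof -
    let ?a = "y - p k" and ?b = "y - p l" and ?\<delta> = "1 / Suc N :: real"
    have ab: "?a \<in> H" "?b \<in> H" using dist p by auto
    have mid: "(1/2) *C (p k + p l) \<in> M" using M p by (simp add: subspace_add subspace_scale)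
    have "?a + ?b = 2 *C (y - (1/2) *C (p k + p l))"
    proof -
      have "2 *C (y - (1/2) *C (p k + p l)) = 2 *C y - (p k + p l)"
        by (simp add: scale_right_diff_distrib)
      also have "2 *C y = y + y" by (metis one_add_one scale_left_distrib scale_one)
      finally show ?thesis by (simp add: algebra_simps)
    qed
    then have "nrm (?a + ?b) = 2 * nrm (y - (1/2) *C (p k + p l))"
      using mid dist by simp
    then have "nrm (?a + ?b) \<ge> 2 * d" using d_le[OF mid] by simp
    then have "(nrm (?a + ?b))\<^sup>2 \<ge> (2 * d)\<^sup>2" using d_ge by (intro power_mono) auto
    moreover have "(nrm (?a + ?b))\<^sup>2 + (nrm (?b - ?a))\<^sup>2 = 2 * (nrm ?a)\<^sup>2 + 2 * (nrm ?b)\<^sup>2"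
      using nrm_add_sq[OF ab] nrm_diff_sq[OF ab(2,1)] ip_commute[OF ab] by simp
    moreover have "?b - ?a = p k - p l" by simp
    moreover have *: "(nrm (y - p j))\<^sup>2 \<le> (d + ?\<delta>)\<^sup>2" if "j \<ge> N" for j
    proof (rule power_mono)
      have "1 / Suc j \<le> ?\<delta>" using that by (simp add: frac_le)
      then show "nrm (y - p j) \<le> d + ?\<delta>" using p(2)[of j] by linarith
    qed (use dist p in auto)
    ultimately have "(nrm (p k - p l))\<^sup>2 \<le> 4 * (d + ?\<delta>)\<^sup>2 - 4 * d\<^sup>2"
      using *[OF that(1)] *[OF that(2)] by (simp add: power2_eq_square)
    also have "\<dots> = 8 * d * ?\<delta> + 4 * (?\<delta> * ?\<delta>)" by (simp add: power2_eq_square algebra_simps)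
    also have "\<dots> \<le> 8 * d * ?\<delta> + 4 * (?\<delta> * 1)" by (intro add_mono mult_left_mono) (use d_ge in auto)
    finally show ?thesis by (simp add: add_divide_distrib)
  qed
  have "\<exists>N. \<forall>k\<ge>N. \<forall>l\<ge>N. nrm (p k - p l) < e" if "e > 0" for e
  proof -
    have "(\<lambda>N. (8 * d + 4) * (1 / real (Suc N))) \<longlonglongrightarrow> (8 * d + 4) * 0"
      by (intro tendsto_mult_left inverse_Suc_tendsto_0)
    then have "\<forall>\<^sub>F N in sequentially. (8 * d + 4) * (1 / real (Suc N)) < e\<^sup>2"
      by (rule order_tendstoD) (use that in simp)
    then obtain N where "(8 * d + 4) * (1 / real (Suc N)) < e\<^sup>2" by (auto simp: eventually_sequentially)
    then have "(nrm (p k - p l))\<^sup>2 < e\<^sup>2" if "k \<ge> N" "l \<ge> N" for k l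
      using par[OF that] by linarith
    then show ?thesis using that by (meson less_eq_real_def power2_less_imp_less)
  qed
  then obtain z where z: "z \<in> H" "(\<lambda>k. nrm (p k - z)) \<longlonglongrightarrow> 0"
    using complete[of p] pH by blast
  have r: "y - z \<in> H" using y z by auto
  have "nrm (y - z) \<le> d"
  proof (rule LIMSEQ_le_const)
    have "(\<lambda>k. d + 1 / real (Suc k) + nrm (p k - z)) \<longlonglongrightarrow> d + 0 + 0"
      by (intro tendsto_add tendsto_const z(2) inverse_Suc_tendsto_0)
    then show "(\<lambda>k. d + 1 / real (Suc k) + nrm (p k - z)) \<longlonglongrightarrow> d" by simp
    have "nrm (y - z) \<le> d + 1 / real (Suc k) + nrm (p k - z)" for k
      using nrm_triangle_diff[OF y pH z(1), of k] p(2)[of k] by linarith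
    then show "\<exists>N. \<forall>k\<ge>N. nrm (y - z) \<le> d + 1 / real (Suc k) + nrm (p k - z)" by blast
  qed
  moreover have "d \<le> nrm (y - z - m)" if "m \<in> M" for m
  proof (rule LIMSEQ_le_const)
    have mH: "m \<in> H" using that M by auto
    show "(\<lambda>k. nrm (y - z - m) + nrm (p k - z)) \<longlonglongrightarrow> nrm (y - z - m)"
      using tendsto_add[OF tendsto_const z(2)] by simp
    have "d \<le> nrm (y - z - m) + nrm (p k - z)" for k
    proof -
      have "d \<le> nrm (y - (p k + m))" using d_le p(1) that M by (simp add: subspace_add)
      also have "y - (p k + m) = (y - z - m) - (p k - z)" by (simp add: algebra_simps)
      also have "nrm \<dots> \<le> nrm (y - z - m) + nrm (p k - z)"
        using nrm_triangle_diff[of "y - z - m" 0 "p k - z"] nrm_diff_commute[of "p k - z" 0] y z mH pH by simp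
      finally show ?thesis .
    qed
    then show "\<exists>N. \<forall>k\<ge>N. d \<le> nrm (y - z - m) + nrm (p k - z)" by blast
  qed
  ultimately have "ip (y - z) m = 0" if "m \<in> M" for m
    using orthogonal_if_nearest_0[OF M r _ that] by force
  then have "y - z = 0" using triv r by blast
  then have "d \<le> 0" using \<open>\<And>m. m \<in> M \<Longrightarrow> d \<le> nrm (y - z - m)\<close>[OF 0] by simp
  then obtain m where "m \<in> M" "nrm (y - m) < \<epsilon>" using d_near[OF \<open>\<epsilon> > 0\<close>] by force
  then show ?thesis using nrm_diff_commute y M by (metis subsetD)
qed

definition linear_operator :: "'h set \<Rightarrow> ('h \<Rightarrow> 'h) \<Rightarrow> bool" where
  "linear_operator A T \<longleftrightarrow> subspace A \<and> A \<subseteq> H \<and> T ` A \<subseteq> H \<and>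
     (\<forall>u\<in>A. \<forall>v\<in>A. T (u + v) = T u + T v) \<and> (\<forall>u\<in>A. \<forall>c. T (c *C u) = c *C T u)"

definition symmetric_operator :: "'h set \<Rightarrow> ('h \<Rightarrow> 'h) \<Rightarrow> bool" where
  "symmetric_operator A T \<longleftrightarrow> linear_operator A T \<and> (\<forall>u\<in>A. \<forall>v\<in>A. ip (T u) v = ip u (T v))"

text \<open>
  The adjoint of \<open>T\<close> on \<open>A\<close> is contained in its closure. For a symmetric operator with dense domain
  this is the nontrivial half of essential self-adjointness, the other inclusion being automatic.
\<close>

definition adjoint_in_closure :: "'h set \<Rightarrow> ('h \<Rightarrow> 'h) \<Rightarrow> bool" where
  "adjoint_in_closure A T \<longleftrightarrow>
     (\<forall>g\<in>H. \<forall>h\<in>H. (\<forall>u\<in>A. ip g (T u) = ip h u) \<longrightarrow>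
        (\<exists>p. (\<forall>k::nat. p k \<in> A) \<and> (\<lambda>k. nrm (p k - g)) \<longlonglongrightarrow> 0 \<and> (\<lambda>k. nrm (T (p k) - h)) \<longlonglongrightarrow> 0))"

abbreviation shifted :: "('h \<Rightarrow> 'h) \<Rightarrow> real \<Rightarrow> 'h \<Rightarrow> 'h" where
  "shifted T \<mu> u \<equiv> T u + (\<i> * of_real \<mu>) *C u"

definition dense_range :: "'h set \<Rightarrow> ('h \<Rightarrow> 'h) \<Rightarrow> bool" where
  "dense_range A T \<longleftrightarrow> (\<forall>y\<in>H. \<forall>\<epsilon>>0. \<exists>u\<in>A. nrm (T u - y) < \<epsilon>)"

lemma linear_operatorD:
  assumes "linear_operator A T"
  shows "subspace A" "A \<subseteq> H" "u \<in> A \<Longrightarrow> T u \<in> H" "u \<in> A \<Longrightarrow> u \<in> H"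
    "\<lbrakk>u \<in> A; v \<in> A\<rbrakk> \<Longrightarrow> T (u + v) = T u + T v" "u \<in> A \<Longrightarrow> T (c *C u) = c *C T u"
  using assms unfolding linear_operator_def by auto

lemma linear_operator_shifted: "linear_operator A T \<Longrightarrow> linear_operator A (shifted T \<mu>)"
  unfolding linear_operator_def by (auto simp: scale_right_distrib mult.commute image_subset_iff subset_iff)

lemma symmetric_operator_add:
  assumes T1: "symmetric_operator A T1" and T2: "symmetric_operator A T2"
  shows "symmetric_operator A (\<lambda>u. T1 u + T2 u)"
proof -
  have lin: "linear_operator A T1" "linear_operator A T2" using assms by (auto simp: symmetric_operator_def)
  note L = linear_operatorD[OF lin(1)] linear_operatorD[OF lin(2)]
  have "(\<lambda>u. T1 u + T2 u) ` A \<subseteq> H" using L(3,9) by auto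
  then have "linear_operator A (\<lambda>u. T1 u + T2 u)"
    using lin unfolding linear_operator_def by (auto simp: scale_right_distrib)
  moreover have "ip (T1 u + T2 u) v = ip u (T1 v + T2 v)" if "u \<in> A" "v \<in> A" for u v
    using assms that L(3,4,9) by (simp add: ip_linear symmetric_operator_def)
  ultimately show ?thesis by (simp add: symmetric_operator_def)
qed

lemma subspace_range: "linear_operator A T \<Longrightarrow> subspace (T ` A)"
proof (rule subspaceI)
  assume lin: "linear_operator A T"
  note L = linear_operatorD[OF lin]
  have "0 \<in> A" using L(1) subspace_0 by blast
  then have "T 0 = 0" using L(6)[of 0 0] by simp
  then show "0 \<in> T ` A" using \<open>0 \<in> A\<close> by force
  show "x + y \<in> T ` A" if "x \<in> T ` A" "y \<in> T ` A" for x y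
  proof -
    obtain a b where "a \<in> A" "b \<in> A" "x = T a" "y = T b"
      using \<open>x \<in> T ` A\<close> \<open>y \<in> T ` A\<close> by blast
    then show ?thesis using L(5)[of a b] subspace_add[OF L(1), of a b] by (metis imageI)
  qed
  show "c *C x \<in> T ` A" if "x \<in> T ` A" for c x
  proof -
    obtain a where "a \<in> A" "x = T a" using \<open>x \<in> T ` A\<close> by blast
    then show ?thesis using L(6)[of a c] subspace_scale[OF L(1), of a c] by (metis imageI)
  qed
qed

lemma dense_range_if_orthogonal_trivial:
  assumes "linear_operator A T"
    and "\<And>r. \<lbrakk>r \<in> H; \<And>u. u \<in> A \<Longrightarrow> ip r (T u) = 0\<rbrakk> \<Longrightarrow> r = 0"
  shows "dense_range A T"
  unfolding dense_range_def
proof (intro ballI allI impI)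
  fix y \<epsilon> assume "y \<in> H" "\<epsilon> > (0::real)"
  have "T ` A \<subseteq> H" using assms(1) by (simp add: linear_operator_def)
  then have "\<exists>m\<in>T ` A. nrm (m - y) < \<epsilon>"
    using subspace_range[OF assms(1)] assms(2) \<open>y \<in> H\<close> \<open>\<epsilon> > 0\<close>
    by (metis dense_if_orthogonal_trivial imageI)
  then show "\<exists>u\<in>A. nrm (T u - y) < \<epsilon>" by blast
qed

text \<open>
  A vector \<open>r\<close> orthogonal to the range of \<open>T + i\<mu>\<close> is an eigenvector of the adjoint, with eigenvalue
  \<open>i\<mu>\<close>. Since the adjoint is contained in the closure of \<open>T\<close>, which is symmetric, its eigenvalues
  are real, so \<open>r = 0\<close>.
\<close>

lemma dense_range_shifted:
  assumes T: "symmetric_operator A T" and esa: "adjoint_in_closure A T" and "\<mu> \<noteq> 0"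
  shows "dense_range A (shifted T \<mu>)"
proof (rule dense_range_if_orthogonal_trivial)
  have lin: "linear_operator A T" using T by (simp add: symmetric_operator_def)
  show "linear_operator A (shifted T \<mu>)" by (rule linear_operator_shifted[OF lin])
  note L = linear_operatorD[OF lin]
  fix r assume r: "r \<in> H" and orth: "\<And>u. u \<in> A \<Longrightarrow> ip r (shifted T \<mu> u) = 0"
  let ?h = "(\<i> * of_real \<mu>) *C r"
  have "ip r (T u) = ip ?h u" if "u \<in> A" for u
    using orth[OF that] that L r by (simp add: ip_linear add_eq_0_iff)
  then obtain p where p: "\<And>k. p k \<in> A" "(\<lambda>k. nrm (p k - r)) \<longlonglongrightarrow> 0" "(\<lambda>k. nrm (T (p k) - ?h)) \<longlonglongrightarrow> 0"
    using esa r unfolding adjoint_in_closure_def by (metis H_closed(4))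
  have "(\<lambda>k. ip (p k) (T (p k))) \<longlonglongrightarrow> ip r ?h" "(\<lambda>k. ip (T (p k)) (p k)) \<longlonglongrightarrow> ip ?h r"
    using p L r by (auto intro!: ip_tendsto)
  moreover have "ip (p k) (T (p k)) = ip (T (p k)) (p k)" for k
    using T p(1) by (simp add: symmetric_operator_def)
  ultimately have "ip r ?h = ip ?h r" using LIMSEQ_unique by simp
  then have "ip r r = 0" using r \<open>\<mu> \<noteq> 0\<close> by (simp add: ip_linear)
  then show "r = 0" using r ip_definite by blast
qed

text \<open>
  The cross term vanishes because the quadratic form of a symmetric operator is real.
\<close>

lemma nrm_shifted_sq:
  assumes "symmetric_operator A T" "u \<in> A"
  shows "(nrm (shifted T \<mu> u))\<^sup>2 = (nrm (T u))\<^sup>2 + (\<mu> * nrm u)\<^sup>2"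
proof -
  have uH: "u \<in> H" "T u \<in> H" using assms unfolding symmetric_operator_def linear_operator_def by auto
  have "ip (T u) u = cnj (ip (T u) u)" using assms ip_commute[OF uH(2,1)] unfolding symmetric_operator_def by simp
  then have "Im (ip (T u) u) = 0" by (metis Reals_cnj_iff complex_is_Real_iff)
  then have "Re (ip (T u) ((\<i> * of_real \<mu>) *C u)) = 0" using uH by (simp add: ip_scale_right)
  then show ?thesis using uH by (simp add: nrm_add_sq norm_mult power_mult_distrib)
qed

lemma nrm_le_shifted:
  assumes "symmetric_operator A T" "u \<in> A"
  shows "nrm (T u) \<le> nrm (shifted T \<mu> u)" "\<bar>\<mu>\<bar> * nrm u \<le> nrm (shifted T \<mu> u)"
proof -
  have uH: "u \<in> H" "T u \<in> H" using assms unfolding symmetric_operator_def linear_operator_def by auto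
  have pos: "0 \<le> nrm (shifted T \<mu> u)" using uH by simp
  have "(\<bar>\<mu>\<bar> * nrm u)\<^sup>2 \<le> (nrm (shifted T \<mu> u))\<^sup>2"
    unfolding nrm_shifted_sq[OF assms] by (simp add: power_mult_distrib)
  then show "\<bar>\<mu>\<bar> * nrm u \<le> nrm (shifted T \<mu> u)" using pos by (rule power2_le_imp_le)
  have "(nrm (T u))\<^sup>2 \<le> (nrm (shifted T \<mu> u))\<^sup>2"
    unfolding nrm_shifted_sq[OF assms] by simp
  then show "nrm (T u) \<le> nrm (shifted T \<mu> u)" using pos by (rule power2_le_imp_le)
qed

text \<open>
  Let \<open>(g, h)\<close> be in the graph of the adjoint, and choose \<open>p k\<close> such that \<open>(T + i\<mu>) (p k)\<close> tends to
  \<open>h + i\<mu>g\<close>. Testing \<open>p k - g\<close> against \<open>(T - i\<mu>) x\<close> moves the operator to the other side, and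
  \<open>\<mu> \<parallel>x\<parallel> \<le> \<parallel>(T - i\<mu>) x\<parallel>\<close> bounds the result by \<open>e k / \<mu>\<close> times the norm of the test vector, where
  \<open>e k\<close> is the approximation error. As these test vectors are dense, \<open>p k\<close> converges to \<open>g\<close>.
\<close>

lemma adjoint_in_closure_if_dense_range:
  assumes T: "symmetric_operator A T" and "\<mu> > 0"
    and dense: "dense_range A (shifted T \<mu>)" "dense_range A (shifted T (- \<mu>))"
  shows "adjoint_in_closure A T"
  unfolding adjoint_in_closure_def
proof (intro ballI impI)
  have lin: "linear_operator A T" using T by (simp add: symmetric_operator_def)
  note L = linear_operatorD[OF lin]
  note L' = linear_operatorD[OF linear_operator_shifted[OF lin]]
  fix g h assume g: "g \<in> H" and h: "h \<in> H" and adj: "\<forall>u\<in>A. ip g (T u) = ip h u"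
  define y where "y = h + (\<i> * of_real \<mu>) *C g"
  have y: "y \<in> H" using g h by (simp add: y_def)
  have "\<forall>k::nat. \<exists>u. u \<in> A \<and> nrm (shifted T \<mu> u - y) < 1 / Suc k"
    using dense(1) y unfolding dense_range_def
    by (meson of_nat_0_less_iff zero_less_Suc zero_less_divide_1_iff)
  then obtain p where p: "\<And>k. p k \<in> A" "\<And>k. nrm (shifted T \<mu> (p k) - y) < 1 / Suc k" by metis
  let ?e = "\<lambda>k. nrm (shifted T \<mu> (p k) - y)"
  have e0: "?e \<longlonglongrightarrow> 0"
  proof (rule Lim_null_comparison)
    show "(\<lambda>k. 1 / real (Suc k)) \<longlonglongrightarrow> 0"
      by (rule inverse_Suc_tendsto_0)
    show "\<forall>\<^sub>F k in sequentially. norm (?e k) \<le> 1 / real (Suc k)"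
      using p y L' by (intro always_eventually) (auto intro: less_imp_le)
  qed
  have near: "nrm (p k - g) \<le> ?e k / \<mu>" for k
  proof -
    let ?w = "p k - g"
    have w: "?w \<in> H" using p L g by auto
    have bound: "cmod (ip ?w (shifted T (- \<mu>) x)) \<le> ?e k / \<mu> * nrm (shifted T (- \<mu>) x)" if "x \<in> A" for x
    proof -
      have "ip (p k) (T x) = ip (T (p k)) x" using T p that unfolding symmetric_operator_def by simp
      moreover have "ip g (T x) = ip h x" using adj that by blast
      ultimately have "ip ?w (shifted T (- \<mu>) x) = ip (shifted T \<mu> (p k) - y) x"
        unfolding y_def using that p L g h by (simp add: ip_linear algebra_simps)
      also have "cmod \<dots> \<le> ?e k * nrm x"
        by (rule Cauchy_Schwarz) (use that L L' p y in auto)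
      also have "\<dots> \<le> ?e k * (nrm (shifted T (- \<mu>) x) / \<mu>)"
        using nrm_le_shifted(2)[OF T that, of "- \<mu>"] \<open>\<mu> > 0\<close> p y L'
        by (intro mult_left_mono) (auto simp: field_simps)
      finally show ?thesis by simp
    qed
    have "nrm ?w * nrm ?w \<le> (?e k / \<mu>) * nrm ?w"
    proof (rule field_le_epsilon)
      fix e :: real assume "e > 0"
      let ?c = "?e k / \<mu>"
      have c: "?c \<ge> 0" using \<open>\<mu> > 0\<close> p y L' by auto
      define \<delta> where "\<delta> = e / (?c + nrm ?w + 1)"
      have pos: "?c + nrm ?w + 1 > 0" using c w by (smt (verit) nrm_ge_0)
      then have "\<delta> > 0" using \<open>e > 0\<close> by (simp add: \<delta>_def)
      then obtain x where x: "x \<in> A" "nrm (shifted T (- \<mu>) x - ?w) < \<delta>"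
        using dense(2) w unfolding dense_range_def by blast
      let ?X = "shifted T (- \<mu>) x"
      have X: "?X \<in> H" using L' x by blast
      have "nrm ?X \<le> nrm ?w + \<delta>" using nrm_triangle_diff[OF X w, of 0] x(2) by simp
      then have "?c * nrm ?X \<le> ?c * nrm ?w + ?c * \<delta>" using c by (metis distrib_left mult_left_mono)
      moreover have "nrm ?w * nrm ?w = cmod (ip ?w ?w)"
        using w by (simp add: ip_self norm_power power2_eq_square norm_mult)
      moreover have "ip ?w ?w = ip ?w ?X - ip ?w (?X - ?w)" using w X by (simp add: ip_diff_right)
      moreover have "cmod (ip ?w (?X - ?w)) \<le> nrm ?w * \<delta>"
        using Cauchy_Schwarz[of ?w "?X - ?w"] w X x(2)
        by (meson H_closed(3) less_imp_le mult_left_mono nrm_ge_0 order_trans)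
      ultimately have "nrm ?w * nrm ?w \<le> ?c * nrm ?w + (?c + nrm ?w) * \<delta>"
        using bound[OF x(1)] norm_triangle_ineq4[of "ip ?w ?X" "ip ?w (?X - ?w)"] by (simp add: distrib_right)
      also have "(?c + nrm ?w) * \<delta> \<le> e"
      proof -
        have "(?c + nrm ?w) * \<delta> \<le> (?c + nrm ?w + 1) * \<delta>" using \<open>\<delta> > 0\<close> by (intro mult_right_mono) auto
        then show ?thesis using pos by (simp add: \<delta>_def)
      qed
      finally show "nrm ?w * nrm ?w \<le> ?c * nrm ?w + e" by simp
    qed
    moreover have "?e k / \<mu> \<ge> 0" using \<open>\<mu> > 0\<close> p y L' by auto
    ultimately show ?thesis using w nrm_ge_0[OF w] by (smt (verit) mult_right_le_imp_le)
  qed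
  have lim: "(\<lambda>k. ?e k / \<mu>) \<longlonglongrightarrow> 0" using tendsto_divide[OF e0 tendsto_const[of \<mu>]] \<open>\<mu> > 0\<close> by simp
  have "0 \<le> nrm (p k - g)" for k using p(1) L(4) g by simp
  from this near lim have p_lim: "(\<lambda>k. nrm (p k - g)) \<longlonglongrightarrow> 0"
    by (rule tendsto_0_if_le)
  have T_near: "nrm (T (p k) - h) \<le> ?e k + \<mu> * nrm (p k - g)" for k
  proof -
    have "T (p k) - h = (shifted T \<mu> (p k) - y) - (\<i> * of_real \<mu>) *C (p k - g)"
      by (simp add: y_def scale_right_diff_distrib algebra_simps)
    also have "nrm \<dots> \<le> ?e k + nrm ((\<i> * of_real \<mu>) *C (p k - g))"
      using nrm_triangle_diff[of "shifted T \<mu> (p k) - y" 0 "(\<i> * of_real \<mu>) *C (p k - g)"]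
        nrm_diff_commute[of 0 "(\<i> * of_real \<mu>) *C (p k - g)"] p y g L L' by simp
    finally show ?thesis using p L g \<open>\<mu> > 0\<close> by (simp add: norm_mult)
  qed
  have e_lim: "(\<lambda>k. ?e k + \<mu> * nrm (p k - g)) \<longlonglongrightarrow> 0"
    using tendsto_add[OF e0 tendsto_mult_left[OF p_lim, of \<mu>]] by simp
  have "0 \<le> nrm (T (p k) - h)" for k using p(1) L(3) h by simp
  from this T_near e_lim have T_lim: "(\<lambda>k. nrm (T (p k) - h)) \<longlonglongrightarrow> 0"
    by (rule tendsto_0_if_le)
  show "\<exists>p. (\<forall>k::nat. p k \<in> A) \<and> (\<lambda>k. nrm (p k - g)) \<longlonglongrightarrow> 0 \<and> (\<lambda>k. nrm (T (p k) - h)) \<longlonglongrightarrow> 0"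
    using p(1) p_lim T_lim by blast
qed

text \<open>
  For \<open>\<bar>\<mu>\<bar>\<close> large, \<open>T - T0\<close> is bounded by \<open>c < 1\<close> relative to \<open>T0 + i\<mu>\<close>. Given \<open>r\<close> orthogonal to the
  range of \<open>T + i\<mu>\<close>, choose \<open>u\<close> with \<open>(T0 + i\<mu>) u\<close> close to \<open>r\<close>; then \<open>(T + i\<mu>) u\<close> is at distance
  less than \<open>\<parallel>r\<parallel>\<close> from \<open>r\<close>, although it is orthogonal to \<open>r\<close>. This contradicts Pythagoras
  unless \<open>r = 0\<close>.
\<close>

lemma Kato_Rellich:
  assumes T0: "symmetric_operator A T0" and dense: "\<And>\<mu>. \<mu> \<noteq> 0 \<Longrightarrow> dense_range A (shifted T0 \<mu>)"
    and T: "symmetric_operator A T"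
    and bound: "\<And>u. u \<in> A \<Longrightarrow> nrm (T u - T0 u) \<le> \<alpha> * nrm u + \<beta> * nrm (T0 u)"
    and "0 \<le> \<alpha>" "0 \<le> \<beta>" "\<beta> < 1"
  shows "adjoint_in_closure A T"
proof -
  have lin: "linear_operator A T" "linear_operator A T0" using T T0 by (auto simp: symmetric_operator_def)
  note L = linear_operatorD[OF lin(1)] linear_operatorD[OF lin(2)]
  \<comment> \<open>This \<open>M\<close> makes the relative bound \<open>\<alpha> / M + \<beta>\<close> at most \<open>(1 + \<beta>) / 2 < 1\<close>.\<close>
  define M where "M = 2 * (\<alpha> + 1) / (1 - \<beta>)"
  have "M > 0" using assms by (simp add: M_def)
  have dense': "dense_range A (shifted T \<mu>)" if \<mu>: "\<bar>\<mu>\<bar> = M" for \<mu>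
  proof (rule dense_range_if_orthogonal_trivial[OF linear_operator_shifted[OF lin(1)]])
    define q where "q = \<alpha> / M"
    define c where "c = q + \<beta>"
    have "c < 1"
    proof -
      have "q = \<alpha> / (\<alpha> + 1) * ((1 - \<beta>) / 2)" by (simp add: q_def M_def)
      also have "\<dots> \<le> 1 * ((1 - \<beta>) / 2)" using assms by (intro mult_right_mono) auto
      finally show ?thesis using \<open>\<beta> < 1\<close> by (simp add: c_def)
    qed
    have "c \<ge> 0" using assms \<open>M > 0\<close> by (simp add: c_def q_def)
    have rel: "nrm (T u - T0 u) \<le> c * nrm (shifted T0 \<mu> u)" if "u \<in> A" for u
    proof -
      have "nrm u \<le> nrm (shifted T0 \<mu> u) / M"
        using nrm_le_shifted(2)[OF T0 that, of \<mu>] \<mu> \<open>M > 0\<close> by (simp add: field_simps)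
      then have "\<alpha> * nrm u + \<beta> * nrm (T0 u) \<le> \<alpha> * (nrm (shifted T0 \<mu> u) / M) + \<beta> * nrm (shifted T0 \<mu> u)"
        using assms nrm_le_shifted(1)[OF T0 that, of \<mu>] by (intro add_mono mult_left_mono) auto
      then show ?thesis using bound[OF that] by (simp add: c_def q_def distrib_right)
    qed
    fix r assume r: "r \<in> H" and orth: "\<And>u. u \<in> A \<Longrightarrow> ip r (shifted T \<mu> u) = 0"
    show "r = 0"
    proof (rule ccontr)
      assume "r \<noteq> 0"
      then have "nrm r > 0" using r nrm_eq_0D nrm_ge_0 by (metis less_eq_real_def)
      define \<delta> where "\<delta> = (1 - c) / 2 * nrm r"
      have "\<delta> > 0" using \<open>nrm r > 0\<close> \<open>c < 1\<close> by (simp add: \<delta>_def)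
      obtain u where u: "u \<in> A" "nrm (shifted T0 \<mu> u - r) < \<delta> / 2"
        using dense[of \<mu>] r \<open>\<delta> > 0\<close> \<mu> \<open>M > 0\<close> unfolding dense_range_def
        by (metis abs_zero half_gt_zero less_irrefl)
      let ?X = "shifted T0 \<mu> u" and ?Y = "shifted T \<mu> u"
      have X: "?X \<in> H" and Y: "?Y \<in> H" using L u by auto
      have "nrm ?X \<le> nrm r + \<delta> / 2" using nrm_triangle_diff[OF X r, of 0] u by simp
      have "nrm (?Y - r) = nrm ((T u - T0 u) + (?X - r))" by (simp add: add_diff_eq)
      also have "\<dots> \<le> nrm (T u - T0 u) + nrm (?X - r)"
        by (rule nrm_triangle) (use X r L u in auto)
      also have "\<dots> < c * (nrm r + \<delta> / 2) + \<delta> / 2"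
        using rel[OF u(1)] u(2) mult_left_mono[OF \<open>nrm ?X \<le> nrm r + \<delta> / 2\<close> \<open>c \<ge> 0\<close>] by linarith
      also have "\<dots> \<le> c * nrm r + \<delta>"
        using mult_right_mono[OF less_imp_le[OF \<open>c < 1\<close>], of "\<delta> / 2"] \<open>\<delta> > 0\<close>
        unfolding distrib_left by linarith
      also have "\<dots> \<le> nrm r" using \<open>c < 1\<close> \<open>nrm r > 0\<close> by (simp add: \<delta>_def field_simps)
      finally have "nrm (r - ?Y) < nrm r" using nrm_diff_commute[OF Y r] by simp
      then have "(nrm (r - ?Y))\<^sup>2 < (nrm r)\<^sup>2" using r Y by (intro power_strict_mono) auto
      moreover have "(nrm (r - ?Y))\<^sup>2 = (nrm r)\<^sup>2 + (nrm ?Y)\<^sup>2"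
        using nrm_diff_sq[OF r Y] orth[OF u(1)] by simp
      ultimately show False by (smt (verit) zero_le_power2)
    qed
  qed
  show ?thesis
    by (rule adjoint_in_closure_if_dense_range[OF T \<open>M > 0\<close> dense' dense']) (use \<open>M > 0\<close> in simp_all)
qed

end

section \<open>Weighted square-summable functions\<close>

definition sq_summable :: "'a set \<Rightarrow> ('a \<Rightarrow> real) \<Rightarrow> ('a \<Rightarrow> complex) \<Rightarrow> bool" where
  "sq_summable X w f \<longleftrightarrow> (\<lambda>x. w x * (cmod (f x))\<^sup>2) summable_on X"

lemma sq_summable_add:
  assumes w: "\<And>x. x \<in> X \<Longrightarrow> 0 \<le> w x" and "sq_summable X w f" "sq_summable X w g"
  shows "sq_summable X w (\<lambda>x. f x + g x)"
proof -
  have "(\<lambda>x. 2 * (w x * (cmod (f x))\<^sup>2) + 2 * (w x * (cmod (g x))\<^sup>2)) summable_on X"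
    using assms(2,3) unfolding sq_summable_def by (intro summable_on_add summable_on_cmult_right)
  then show ?thesis unfolding sq_summable_def
  proof (rule summable_on_comparison_test)
    fix x assume x: "x \<in> X"
    have "(cmod (f x + g x))\<^sup>2 \<le> (cmod (f x) + cmod (g x))\<^sup>2"
      by (intro power_mono norm_triangle_ineq norm_ge_zero)
    also have "\<dots> \<le> 2 * (cmod (f x))\<^sup>2 + 2 * (cmod (g x))\<^sup>2"
      using sum_squares_bound[of "cmod (f x)" "cmod (g x)"] by (simp add: power2_sum)
    finally show "w x * (cmod (f x + g x))\<^sup>2 \<le> 2 * (w x * (cmod (f x))\<^sup>2) + 2 * (w x * (cmod (g x))\<^sup>2)"
      using mult_left_mono[OF _ w[OF x]] by (fastforce simp: algebra_simps)
    show "0 \<le> w x * (cmod (f x + g x))\<^sup>2" using w x by simp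
  qed
qed

lemma sq_summable_scale: "sq_summable X w f \<Longrightarrow> sq_summable X w (\<lambda>x. c * f x)"
  unfolding sq_summable_def using summable_on_cmult_right[of _ X "(cmod c)\<^sup>2"]
  by (fastforce simp: norm_mult power_mult_distrib mult_ac)

lemma sq_summable_diff:
  assumes "\<And>x. x \<in> X \<Longrightarrow> 0 \<le> w x" "sq_summable X w f" "sq_summable X w g"
  shows "sq_summable X w (\<lambda>x. f x - g x)"
  using sq_summable_add[OF assms(1,2) sq_summable_scale[OF assms(3), of "-1"]] by simp

lemma sq_summable_inner:
  assumes w: "\<And>x. x \<in> X \<Longrightarrow> 0 \<le> w x" and "sq_summable X w f" "sq_summable X w g"
  shows "(\<lambda>x. of_real (w x) * cnj (f x) * g x) summable_on X"
proof (rule abs_summable_summable, rule Infinite_Sum.abs_summable_on_comparison_test')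
  show "(\<lambda>x. w x * (cmod (f x))\<^sup>2 + w x * (cmod (g x))\<^sup>2) summable_on X"
    using assms(2,3) unfolding sq_summable_def by (intro summable_on_add)
  fix x assume x: "x \<in> X"
  have "cmod (f x) * cmod (g x) \<le> (cmod (f x))\<^sup>2 + (cmod (g x))\<^sup>2"
    using sum_squares_bound[of "cmod (f x)" "cmod (g x)"] mult_nonneg_nonneg[of "cmod (f x)" "cmod (g x)"]
    by (simp del: mult_nonneg_nonneg)
  then show "cmod (of_real (w x) * cnj (f x) * g x) \<le> w x * (cmod (f x))\<^sup>2 + w x * (cmod (g x))\<^sup>2"
    using mult_left_mono[OF _ w[OF x]] w[OF x] by (fastforce simp: norm_mult algebra_simps)
qed

text \<open>
  A Cauchy sequence converges pointwise because the weights are positive. The bound on the distance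
  passes to the limit on each finite set of points, hence to the whole sum. Functions are required
  to vanish off \<open>X\<close> so that the limit exists at every point of the type.
\<close>

lemma weighted_l2_complete:
  fixes p :: "nat \<Rightarrow> 'a \<Rightarrow> complex"
  assumes w: "\<And>x. x \<in> X \<Longrightarrow> 0 < w x" and p: "\<And>k. sq_summable X w (p k)"
    and Cauchy: "\<And>\<epsilon>. \<epsilon> > 0 \<Longrightarrow> \<exists>N. \<forall>k\<ge>N. \<forall>l\<ge>N. (\<Sum>\<^sub>\<infinity>x\<in>X. w x * (cmod (p k x - p l x))\<^sup>2) < \<epsilon>"
    and zero: "\<And>k x. x \<notin> X \<Longrightarrow> p k x = 0"
  shows "\<exists>u. (\<forall>x. (\<lambda>k. p k x) \<longlonglongrightarrow> u x) \<and> sq_summable X w u \<and>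
    (\<lambda>k. \<Sum>\<^sub>\<infinity>x\<in>X. w x * (cmod (p k x - u x))\<^sup>2) \<longlonglongrightarrow> 0"
proof -
  have w0: "\<And>x. x \<in> X \<Longrightarrow> 0 \<le> w x" using w by (simp add: less_imp_le)
  have diff: "(\<lambda>x. w x * (cmod (p k x - p l x))\<^sup>2) summable_on X" for k l
    using sq_summable_diff[OF w0 p p] unfolding sq_summable_def by simp
  have finite_le: "(\<Sum>x\<in>F. w x * (cmod (p k x - p l x))\<^sup>2) \<le> (\<Sum>\<^sub>\<infinity>x\<in>X. w x * (cmod (p k x - p l x))\<^sup>2)"
    if "finite F" "F \<subseteq> X" for F k l
    by (rule finite_sum_le_infsum[OF diff that]) (use w0 in simp)
  have conv: "convergent (\<lambda>k. p k x)" for x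
  proof (cases "x \<in> X")
    case True
    have "Cauchy (\<lambda>k. p k x)"
    proof (rule metric_CauchyI)
      fix e :: real assume "e > 0"
      then have "w x * e\<^sup>2 > 0" using w True by simp
      then obtain N where N: "\<forall>k\<ge>N. \<forall>l\<ge>N. (\<Sum>\<^sub>\<infinity>x\<in>X. w x * (cmod (p k x - p l x))\<^sup>2) < w x * e\<^sup>2"
        using Cauchy by blast
      have "dist (p k x) (p l x) < e" if "k \<ge> N" "l \<ge> N" for k l
      proof -
        have "w x * (cmod (p k x - p l x))\<^sup>2 \<le> (\<Sum>\<^sub>\<infinity>x\<in>X. w x * (cmod (p k x - p l x))\<^sup>2)"
          using finite_le[of "{x}" k l] True by simp
        also have "\<dots> < w x * e\<^sup>2" using N that by blast
        finally have "w x * (cmod (p k x - p l x))\<^sup>2 < w x * e\<^sup>2" .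
        then have "(cmod (p k x - p l x))\<^sup>2 < e\<^sup>2" using w[OF True] by simp
        then show ?thesis using \<open>e > 0\<close> by (simp add: dist_norm power2_less_imp_less)
      qed
      then show "\<exists>N. \<forall>k\<ge>N. \<forall>l\<ge>N. dist (p k x) (p l x) < e" by blast
    qed
    then show ?thesis by (rule Cauchy_convergent)
  qed (simp add: zero convergent_const)
  define u where "u x = lim (\<lambda>k. p k x)" for x
  have lim: "(\<lambda>k. p k x) \<longlonglongrightarrow> u x" for x
    using conv unfolding u_def by (simp add: convergent_LIMSEQ_iff)
  have tail: "\<exists>N. \<forall>k\<ge>N. (\<lambda>x. w x * (cmod (p k x - u x))\<^sup>2) summable_on X \<and>
      (\<Sum>\<^sub>\<infinity>x\<in>X. w x * (cmod (p k x - u x))\<^sup>2) \<le> \<epsilon>" if "\<epsilon> > 0" for \<epsilon>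
  proof -
    obtain N where N: "\<forall>k\<ge>N. \<forall>l\<ge>N. (\<Sum>\<^sub>\<infinity>x\<in>X. w x * (cmod (p k x - p l x))\<^sup>2) < \<epsilon>"
      using Cauchy \<open>\<epsilon> > 0\<close> by blast
    have fin: "(\<Sum>x\<in>F. w x * (cmod (p k x - u x))\<^sup>2) \<le> \<epsilon>" if "finite F" "F \<subseteq> X" "k \<ge> N" for F k
    proof (rule tendsto_upperbound)
      show "(\<lambda>l. \<Sum>x\<in>F. w x * (cmod (p k x - p l x))\<^sup>2) \<longlonglongrightarrow> (\<Sum>x\<in>F. w x * (cmod (p k x - u x))\<^sup>2)"
        by (intro tendsto_intros lim)
      show "\<forall>\<^sub>F l in sequentially. (\<Sum>x\<in>F. w x * (cmod (p k x - p l x))\<^sup>2) \<le> \<epsilon>"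
        using finite_le[OF that(1,2)] N that(3) unfolding eventually_sequentially
        by (meson less_imp_le order_trans)
    qed simp
    have "(\<lambda>x. w x * (cmod (p k x - u x))\<^sup>2) summable_on X" if "k \<ge> N" for k
      by (rule nonneg_bdd_above_summable_on) (use w0 fin that in \<open>auto intro!: bdd_aboveI[of _ \<epsilon>]\<close>)
    moreover from this have "(\<Sum>\<^sub>\<infinity>x\<in>X. w x * (cmod (p k x - u x))\<^sup>2) \<le> \<epsilon>" if "k \<ge> N" for k
      using fin that by (intro infsum_le_finite_sums) auto
    ultimately show ?thesis by blast
  qed
  have "sq_summable X w u"
  proof -
    obtain N where "(\<lambda>x. w x * (cmod (p N x - u x))\<^sup>2) summable_on X" using tail[of 1] by auto
    then have "sq_summable X w (\<lambda>x. p N x - u x)" by (simp add: sq_summable_def)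
    then show ?thesis using sq_summable_diff[OF w0 p, of "\<lambda>x. p N x - u x" N] by simp
  qed
  moreover have "(\<lambda>k. \<Sum>\<^sub>\<infinity>x\<in>X. w x * (cmod (p k x - u x))\<^sup>2) \<longlonglongrightarrow> 0"
  proof (rule LIMSEQ_I)
    fix r :: real assume "r > 0"
    then obtain N where N: "\<forall>k\<ge>N. (\<Sum>\<^sub>\<infinity>x\<in>X. w x * (cmod (p k x - u x))\<^sup>2) \<le> r / 2" using tail[of "r/2"] by auto
    have "norm ((\<Sum>\<^sub>\<infinity>x\<in>X. w x * (cmod (p k x - u x))\<^sup>2) - 0) < r" if "k \<ge> N" for k
    proof -
      have "0 \<le> (\<Sum>\<^sub>\<infinity>x\<in>X. w x * (cmod (p k x - u x))\<^sup>2)" by (rule infsum_nonneg) (use w0 in simp)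
      moreover have "(\<Sum>\<^sub>\<infinity>x\<in>X. w x * (cmod (p k x - u x))\<^sup>2) \<le> r / 2" using N that by blast
      ultimately show ?thesis using \<open>r > 0\<close> unfolding real_norm_def by linarith
    qed
    then show "\<exists>N. \<forall>k\<ge>N. norm ((\<Sum>\<^sub>\<infinity>x\<in>X. w x * (cmod (p k x - u x))\<^sup>2) - 0) < r" by blast
  qed
  ultimately show ?thesis using lim by blast
qed


section \<open>Simplices and their weights\<close>

lemma adjacent_sym:
  assumes "is_weighted_complex S" shows "adjacent S x y \<Longrightarrow> adjacent S y x"
proof -
  assume a: "adjacent S x y"
  have t: "Transposition.transpose 0 (Suc 0) permutes {..<length [x, y]}" by (rule permutes_swap_id) auto
  have "1 < max_vertices S" using assms by (simp add: is_weighted_complex_def)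
  then have "weight S (permute_list (Transposition.transpose 0 (Suc 0)) [x, y]) = weight S [x, y]"
    using assms a t unfolding is_weighted_complex_def adjacent_def
    by (metis (no_types, lifting) One_nat_def empty_set empty_subsetI insert_subset length_Cons list.set(2) list.size(3) Suc_eq_plus1)
  moreover have "permute_list (Transposition.transpose 0 (Suc 0)) [x, y] = [y, x]" by (simp add: permute_list_def)
  ultimately show "adjacent S y x" using a by (simp add: adjacent_def)
qed

lemma not_adjacent_refl: "is_weighted_complex S \<Longrightarrow> \<not> adjacent S x x"
  by (auto simp: is_weighted_complex_def adjacent_def)

definition clique :: "'v weighted_complex \<Rightarrow> 'v set \<Rightarrow> bool" where
  "clique S A \<longleftrightarrow> A \<subseteq> vertices S \<and> (\<forall>x\<in>A. \<forall>y\<in>A. x \<noteq> y \<longrightarrow> adjacent S x y)"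

lemma simplices_iff:
  assumes "is_weighted_complex S"
  shows "xs \<in> simplices S i \<longleftrightarrow> length xs = i + 1 \<and> distinct xs \<and> clique S (set xs)"
proof
  assume xs: "xs \<in> simplices S i"
  have "distinct xs"
    unfolding distinct_conv_nth using xs not_adjacent_refl[OF assms] unfolding simplices_def by fastforce
  moreover have "adjacent S x y" if "x \<in> set xs" "y \<in> set xs" "x \<noteq> y" for x y
    using that xs unfolding simplices_def in_set_conv_nth by blast
  ultimately show "length xs = i + 1 \<and> distinct xs \<and> clique S (set xs)"
    using xs by (simp add: simplices_def clique_def)
next
  assume "length xs = i + 1 \<and> distinct xs \<and> clique S (set xs)"
  then show "xs \<in> simplices S i"
    by (simp add: simplices_def clique_def nth_eq_iff_index_eq)
qed

lemma all_simplices_iff: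
  assumes "is_weighted_complex S"
  shows "xs \<in> all_simplices S \<longleftrightarrow> xs \<noteq> [] \<and> length xs \<le> max_vertices S \<and> distinct xs \<and> clique S (set xs)"
  unfolding all_simplices_def using simplices_iff[OF assms]
  by (cases xs) (auto simp: Suc_le_eq)

lemma weighted_complexD:
  assumes "is_weighted_complex S" "xs \<in> all_simplices S"
  shows "0 < weight S xs" "p permutes {..<length xs} \<Longrightarrow> weight S (permute_list p xs) = weight S xs"
proof -
  obtain i where i: "i < max_vertices S" "xs \<in> simplices S i" using assms(2) by (auto simp: all_simplices_def)
  then have len: "length xs = i + 1 \<and> set xs \<subseteq> vertices S" by (simp add: simplices_def)
  then have *: "(0 < weight S xs \<longleftrightarrow> xs \<in> simplices S i) \<and>
      (\<forall>p. p permutes {..<length xs} \<longrightarrow> weight S (permute_list p xs) = weight S xs)"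
    using assms(1) i(1) unfolding is_weighted_complex_def by simp
  then show "0 < weight S xs" using i(2) by simp
  show "p permutes {..<length xs} \<Longrightarrow> weight S (permute_list p xs) = weight S xs" using * by simp
qed

lemmas weight_pos = weighted_complexD(1)

lemma weight_mset_cong:
  assumes "is_weighted_complex S" "mset xs = mset ys" "ys \<in> all_simplices S"
  shows "weight S xs = weight S ys"
  using mset_eq_permutation[OF assms(2)] weighted_complexD(2)[OF assms(1,3)] by metis

section \<open>The Hilbert space of square-summable cochains\<close>

text \<open>
  The factor \<open>1 / (i + 1)!\<close> of the inner product in degree \<open>i\<close> is absorbed into the weight; this turns
  the sum over all degrees into one weighted sum over all simplices.
\<close>

definition simplex_weight :: "'v weighted_complex \<Rightarrow> 'v list \<Rightarrow> real" where
  "simplex_weight S xs = weight S xs / fact (length xs)"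

lemma simplex_weight_pos:
  "\<lbrakk>is_weighted_complex S; xs \<in> all_simplices S\<rbrakk> \<Longrightarrow> 0 < simplex_weight S xs"
  by (simp add: simplex_weight_def weight_pos)

lemma simplices_disjoint: "i \<noteq> j \<Longrightarrow> simplices S i \<inter> simplices S j = {}"
  by (auto simp: simplices_def)

lemma l2_cochains_iff:
  "f \<in> l2_cochains S \<longleftrightarrow> f \<in> cochains S \<and> sq_summable (all_simplices S) (simplex_weight S) f"
proof -
  let ?f = "\<lambda>xs. weight S xs * (cmod (f xs))\<^sup>2" and ?g = "\<lambda>xs. simplex_weight S xs * (cmod (f xs))\<^sup>2"
  have level: "?f summable_on simplices S i \<longleftrightarrow> ?g summable_on simplices S i" for i
  proof -
    have "?g summable_on simplices S i \<longleftrightarrow> (\<lambda>xs. (1 / fact (i + 1)) * ?f xs) summable_on simplices S i"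
      by (rule summable_on_cong) (simp add: simplices_def simplex_weight_def)
    also have "\<dots> \<longleftrightarrow> ?f summable_on simplices S i"
      by (rule summable_on_cmult_right') simp
    finally show ?thesis by simp
  qed
  have "?g summable_on all_simplices S \<longleftrightarrow> (\<forall>i<max_vertices S. ?g summable_on simplices S i)"
  proof
    assume "?g summable_on all_simplices S"
    then show "\<forall>i<max_vertices S. ?g summable_on simplices S i"
      unfolding all_simplices_def by (meson UN_upper lessThan_iff summable_on_subset_banach)
  next
    assume "\<forall>i<max_vertices S. ?g summable_on simplices S i"
    then show "?g summable_on all_simplices S"
      unfolding all_simplices_def by (intro summable_on_finite_union_disjoint simplices_disjoint) auto
  qed
  then show ?thesis by (simp add: l2_cochains_def sq_summable_def level)
qed

lemma l2_inner_eq: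
  assumes S: "is_weighted_complex S" and f: "f \<in> l2_cochains S" and g: "g \<in> l2_cochains S"
  shows "l2_inner S f g = (\<Sum>\<^sub>\<infinity>xs\<in>all_simplices S. of_real (simplex_weight S xs) * cnj (f xs) * g xs)"
proof -
  let ?h = "\<lambda>xs. of_real (simplex_weight S xs) * cnj (f xs) * g xs"
  have sum: "?h summable_on all_simplices S"
    using f g simplex_weight_pos[OF S] by (intro sq_summable_inner) (auto simp: l2_cochains_iff less_imp_le)
  have "(1 / fact (i + 1)) * (\<Sum>\<^sub>\<infinity>xs\<in>simplices S i. of_real (weight S xs) * cnj (f xs) * g xs)
      = infsum ?h (simplices S i)" for i
    unfolding infsum_cmult_right'[symmetric]
    by (rule infsum_cong) (simp add: simplices_def simplex_weight_def)
  then have "l2_inner S f g = (\<Sum>i<max_vertices S. infsum ?h (simplices S i))"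
    unfolding l2_inner_def by simp
  also have "\<dots> = infsum ?h (\<Union>i<max_vertices S. simplices S i)"
    using sum simplices_disjoint unfolding all_simplices_def
    by (intro sum_infsum) (auto intro: summable_on_subset_banach)
  finally show ?thesis by (simp add: all_simplices_def)
qed

lemma l2_inner_self:
  assumes S: "is_weighted_complex S" and f: "f \<in> l2_cochains S"
  shows "l2_inner S f f = of_real (\<Sum>\<^sub>\<infinity>xs\<in>all_simplices S. simplex_weight S xs * (cmod (f xs))\<^sup>2)"
proof -
  have A: "((\<lambda>xs. complex_of_real (simplex_weight S xs * (cmod (f xs))\<^sup>2)) has_sum
      of_real (\<Sum>\<^sub>\<infinity>xs\<in>all_simplices S. simplex_weight S xs * (cmod (f xs))\<^sup>2)) (all_simplices S)"
    using f by (simp only: has_sum_of_real_iff has_sum_infsum l2_cochains_iff sq_summable_def)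
  have eq: "(\<lambda>xs. complex_of_real (simplex_weight S xs * (cmod (f xs))\<^sup>2)) =
      (\<lambda>xs. of_real (simplex_weight S xs) * cnj (f xs) * f xs)"
    by (simp only: of_real_mult complex_norm_square mult_ac)
  show ?thesis unfolding l2_inner_eq[OF assms f] eq[symmetric] using A by (rule infsumI)
qed

lemma l2_norm_eq:
  assumes "is_weighted_complex S" "f \<in> l2_cochains S"
  shows "l2_norm S f = sqrt (\<Sum>\<^sub>\<infinity>xs\<in>all_simplices S. simplex_weight S xs * (cmod (f xs))\<^sup>2)"
  unfolding l2_norm_def l2_inner_self[OF assms] by simp

definition scale_cochain :: "complex \<Rightarrow> 'v cochain \<Rightarrow> 'v cochain" where
  "scale_cochain c f = (\<lambda>xs. c * f xs)"

lemma scale_cochain_apply [simp]: "scale_cochain c f xs = c * f xs"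
  by (simp add: scale_cochain_def)

lemma cochains_closed:
  "0 \<in> cochains S"
  "\<lbrakk>f \<in> cochains S; g \<in> cochains S\<rbrakk> \<Longrightarrow> f + g \<in> cochains S"
  "f \<in> cochains S \<Longrightarrow> scale_cochain c f \<in> cochains S"
  by (auto simp: cochains_def algebra_simps)

lemma vector_space_cochain: "vector_space scale_cochain"
  by unfold_locales (auto simp: fun_eq_iff algebra_simps)

lemma complex_hilbert_space_l2_cochains:
  assumes S: "is_weighted_complex S"
  shows "complex_hilbert_space scale_cochain (l2_cochains S) (l2_inner S) (l2_norm S)"
proof -
  interpret vector_space scale_cochain by (rule vector_space_cochain)
  let ?X = "all_simplices S" and ?w = "simplex_weight S" and ?H = "l2_cochains S"
  have w: "xs \<in> ?X \<Longrightarrow> 0 < ?w xs" for xs using simplex_weight_pos[OF S] .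
  then have w0: "xs \<in> ?X \<Longrightarrow> 0 \<le> ?w xs" for xs by (simp add: less_imp_le)
  have sq: "sq_summable ?X ?w f" if "f \<in> ?H" for f using that by (simp add: l2_cochains_iff)
  have sum: "(\<lambda>xs. of_real (?w xs) * cnj (f xs) * g xs) summable_on ?X" if "f \<in> ?H" "g \<in> ?H" for f g
    using sq_summable_inner[OF w0 sq sq] that by blast
  have sub: "subspace ?H"
  proof (rule subspaceI)
    show "0 \<in> ?H" by (simp add: l2_cochains_iff cochains_closed sq_summable_def)
    show "f + g \<in> ?H" if "f \<in> ?H" "g \<in> ?H" for f g
    proof -
      have "sq_summable ?X ?w (f + g)"
        using sq_summable_add[OF w0 sq[OF that(1)] sq[OF that(2)]] by (simp add: plus_fun_def)
      then show ?thesis using that by (simp add: l2_cochains_iff cochains_closed)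
    qed
    show "scale_cochain c f \<in> ?H" if "f \<in> ?H" for c f
    proof -
      have "sq_summable ?X ?w (scale_cochain c f)"
        using sq_summable_scale[OF sq[OF that]] by (simp add: scale_cochain_def)
      then show ?thesis using that by (simp add: l2_cochains_iff cochains_closed)
    qed
  qed
  note eq = l2_inner_eq[OF S]
  show ?thesis
  proof unfold_locales
    show "subspace ?H" by (rule sub)
    fix f g h assume f: "f \<in> ?H" and g: "g \<in> ?H" and h: "h \<in> ?H"
    show "l2_inner S f (g + h) = l2_inner S f g + l2_inner S f h"
      unfolding eq[OF f g] eq[OF f h] eq[OF f subspace_add[OF sub g h]]
      by (subst infsum_add[OF sum[OF f g] sum[OF f h], symmetric]) (simp add: algebra_simps)
  next
    fix f g c assume f: "f \<in> ?H" and g: "g \<in> ?H"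
    show "l2_inner S f (scale_cochain c g) = c * l2_inner S f g"
      unfolding eq[OF f g] eq[OF f subspace_scale[OF sub g]] infsum_cmult_right'[symmetric]
      by (simp add: mult_ac)
    show "l2_inner S f g = cnj (l2_inner S g f)"
      unfolding eq[OF f g] eq[OF g f] infsum_cnj[symmetric] by (simp add: mult_ac)
  next
    fix f assume f: "f \<in> ?H"
    note self = l2_inner_self[OF S f]
    show "0 \<le> Re (l2_inner S f f)" unfolding self by (simp add: infsum_nonneg w0)
    assume "l2_inner S f f = 0"
    then have 0: "(\<Sum>\<^sub>\<infinity>xs\<in>?X. ?w xs * (cmod (f xs))\<^sup>2) = 0" unfolding self by simp
    have "f xs = 0" for xs
    proof (cases "xs \<in> ?X")
      case True
      have "?w xs * (cmod (f xs))\<^sup>2 = 0"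
        using nonneg_infsum_le_0D[OF _ _ _ True] 0 sq[OF f] w0 unfolding sq_summable_def
        by (metis (no_types, lifting) mult_nonneg_nonneg order_refl zero_le_power2)
      then show ?thesis using w[OF True] by simp
    qed (use f in \<open>simp add: l2_cochains_iff cochains_def\<close>)
    then show "f = 0" by (simp add: fun_eq_iff)
  next
    show "l2_norm S f = sqrt (Re (l2_inner S f f))" for f by (rule l2_norm_def)
  next
    fix p :: "nat \<Rightarrow> 'a list \<Rightarrow> complex"
    assume p: "\<And>k. p k \<in> ?H"
      and Cauchy: "\<And>\<epsilon>. \<epsilon> > 0 \<Longrightarrow> \<exists>N. \<forall>k\<ge>N. \<forall>l\<ge>N. l2_norm S (p k - p l) < \<epsilon>"
    have norm: "l2_norm S (f - g) = sqrt (\<Sum>\<^sub>\<infinity>xs\<in>?X. ?w xs * (cmod (f xs - g xs))\<^sup>2)"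
      if "f \<in> ?H" "g \<in> ?H" for f g
      unfolding l2_norm_eq[OF S subspace_diff[OF sub that]] by simp
    have "\<exists>u. (\<forall>xs. (\<lambda>k. p k xs) \<longlonglongrightarrow> u xs) \<and> sq_summable ?X ?w u \<and>
        (\<lambda>k. \<Sum>\<^sub>\<infinity>xs\<in>?X. ?w xs * (cmod (p k xs - u xs))\<^sup>2) \<longlonglongrightarrow> 0"
    proof (rule weighted_l2_complete)
      show "\<exists>N. \<forall>k\<ge>N. \<forall>l\<ge>N. (\<Sum>\<^sub>\<infinity>xs\<in>?X. ?w xs * (cmod (p k xs - p l xs))\<^sup>2) < \<epsilon>" if "\<epsilon> > 0" for \<epsilon>
        using Cauchy[of "sqrt \<epsilon>"] that by (simp add: norm[OF p p])
      show "p k xs = 0" if "xs \<notin> ?X" for k xs using p[of k] that by (simp add: l2_cochains_iff cochains_def)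
    qed (use w sq p in auto)
    then obtain u where u: "\<And>xs. (\<lambda>k. p k xs) \<longlonglongrightarrow> u xs" "sq_summable ?X ?w u"
        "(\<lambda>k. \<Sum>\<^sub>\<infinity>xs\<in>?X. ?w xs * (cmod (p k xs - u xs))\<^sup>2) \<longlonglongrightarrow> 0" by blast
    have pc: "p k \<in> cochains S" for k using p by (simp add: l2_cochains_iff)
    have "u \<in> cochains S"
      unfolding cochains_def
    proof (intro CollectI conjI allI impI ballI)
      fix xs assume "xs \<notin> ?X"
      then have "(\<lambda>k. p k xs) = (\<lambda>k. 0)" using pc by (simp add: cochains_def)
      then show "u xs = 0" using u(1)[of xs] by (simp add: LIMSEQ_const_iff)
    next
      fix xs \<pi> assume "xs \<in> ?X" "\<pi> permutes {..<length xs}"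
      then have "(\<lambda>k. p k (permute_list \<pi> xs)) = (\<lambda>k. of_int (sign \<pi>) * p k xs)"
        using pc by (simp add: cochains_def)
      then show "u (permute_list \<pi> xs) = of_int (sign \<pi>) * u xs"
        using u(1)[of "permute_list \<pi> xs"] tendsto_mult_left[OF u(1)[of xs], of "of_int (sign \<pi>)"]
        by (metis LIMSEQ_unique)
    qed
    then have uH: "u \<in> ?H" using u(2) by (simp add: l2_cochains_iff)
    have "(\<lambda>k. l2_norm S (p k - u)) \<longlonglongrightarrow> 0"
      unfolding norm[OF p uH] using tendsto_real_sqrt[OF u(3)] by simp
    then show "\<exists>u\<in>?H. (\<lambda>k. l2_norm S (p k - u)) \<longlonglongrightarrow> 0" using uH by blast
  qed
qed


section \<open>Alternating functions\<close>

lemma permute_list_adjacent: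
  "permute_list (Transposition.transpose (length us) (Suc (length us))) (us @ x # y # vs) = us @ y # x # vs"
  (is "permute_list ?\<tau> ?xs = ?ys")
proof (rule nth_equalityI)
  fix i assume "i < length (permute_list ?\<tau> ?xs)"
  then have i: "i < length ?xs" by simp
  consider "i < length us" | "i = length us" | "i = Suc (length us)" | j where "i = length us + 2 + j"
    by (metis add_2_eq_Suc' less_antisym less_iff_Suc_add add_Suc_right add_Suc linorder_neqE_nat not_less_eq)
  then have "?xs ! ?\<tau> i = ?ys ! i"
    by cases (simp_all add: nth_append Transposition.transpose_def)
  moreover have "?\<tau> permutes {..<length ?xs}" by (rule permutes_swap_id) auto
  ultimately show "permute_list ?\<tau> ?xs ! i = ?ys ! i" using i by (simp add: permute_list_nth)
qed simp

text \<open>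
  Swaps of adjacent entries generate all permutations: the transposition of \<open>i\<close> and \<open>j + 1\<close> is the
  transposition of \<open>i\<close> and \<open>j\<close> conjugated by an adjacent swap.
\<close>

lemma alternating_permute_list:
  fixes f :: "'a list \<Rightarrow> complex"
  assumes alt: "\<And>us x y vs. f (us @ y # x # vs) = - f (us @ x # y # vs)"
    and p: "p permutes {..<length xs}"
  shows "f (permute_list p xs) = of_int (sign p) * f xs"
proof -
  let ?T = "Transposition.transpose"
  have adj: "f (permute_list (?T i (Suc i)) xs) = - f xs" if "Suc i < length xs" for i and xs :: "'a list"
  proof -
    have xs: "xs = take i xs @ xs ! i # xs ! Suc i # drop (Suc (Suc i)) xs"
      using that by (metis Cons_nth_drop_Suc Suc_lessD append_take_drop_id)
    have i: "length (take i xs) = i" using that by simp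
    show ?thesis
      using permute_list_adjacent[of "take i xs" "xs ! i" "xs ! Suc i" "drop (Suc (Suc i)) xs"] alt
      unfolding i xs[symmetric] by (metis xs)
  qed
  have perm: "?T i j permutes {..<n}" if "i < n" "j < n" for i j n :: nat
    using that by (intro permutes_swap_id) auto
  have less: "f (permute_list (?T i j) xs) = - f xs" if "i < j" "j < length xs" for i j and xs :: "'a list"
    using that
  proof (induction j arbitrary: xs)
    case (Suc j)
    show ?case
    proof (cases "i = j")
      case False
      then have "i < j" using Suc.prems by simp
      have "?T i (Suc j) = ?T j (Suc j) \<circ> ?T i j \<circ> ?T j (Suc j)"
        using \<open>i < j\<close> by (auto simp: fun_eq_iff Transposition.transpose_def)
      then have "permute_list (?T i (Suc j)) xs =
          permute_list (?T j (Suc j)) (permute_list (?T i j) (permute_list (?T j (Suc j)) xs))"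
        using Suc.prems by (simp add: permute_list_compose perm)
      then show ?thesis using Suc.prems Suc.IH \<open>i < j\<close> adj by simp
    qed (use Suc.prems adj in simp)
  qed simp
  have flip: "f (permute_list (?T i j) xs) = - f xs"
    if "i < length xs" "j < length xs" "i \<noteq> j" for i j and xs :: "'a list"
    using that less[of i j xs] less[of j i xs] by (cases "i < j") (auto simp: transpose_commute)
  show ?thesis
    using finite_lessThan p
  proof (induction rule: permutes_rev_induct)
    case (swap a b p)
    have "permutation p" using swap.hyps permutation_permutes by blast
    then have "sign (p \<circ> ?T a b) = - sign p"
      using swap.hyps by (simp add: sign_compose permutation_swap_id sign_swap_id)
    moreover have "permute_list (p \<circ> ?T a b) xs = permute_list (?T a b) (permute_list p xs)"
      using swap.hyps by (intro permute_list_compose perm) auto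
    moreover have "f (permute_list (?T a b) (permute_list p xs)) = - f (permute_list p xs)"
      using flip[of a "permute_list p xs" b] swap.hyps by simp
    ultimately show ?case by (simp only: swap.IH) simp
  qed simp
qed

lemma all_simplices_mset_cong:
  assumes "is_weighted_complex S" "mset xs = mset ys"
  shows "xs \<in> all_simplices S \<longleftrightarrow> ys \<in> all_simplices S"
  using mset_eq_setD[OF assms(2)] mset_eq_length[OF assms(2)] mset_eq_imp_distinct_iff[OF assms(2)]
  unfolding all_simplices_iff[OF assms(1)] by (metis length_0_conv)

text \<open>
  Alternation under adjacent swaps is the form in which \<open>d f\<close> and \<open>\<delta> g\<close> are shown to be cochains: such
  a swap interchanges two faces and acts on every other face as an adjacent swap.
\<close>

lemma cochains_iff:
  fixes S :: "'v weighted_complex"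
  assumes S: "is_weighted_complex S"
  shows "f \<in> cochains S \<longleftrightarrow> (\<forall>xs. xs \<notin> all_simplices S \<longrightarrow> f xs = 0) \<and>
    (\<forall>us x y vs. f (us @ y # x # vs) = - f (us @ x # y # vs))"
proof (intro iffI conjI allI)
  assume f: "f \<in> cochains S"
  then show "xs \<notin> all_simplices S \<longrightarrow> f xs = 0" for xs by (simp add: cochains_def)
  fix us vs :: "'v list" and x y
  let ?xs = "us @ x # y # vs" and ?\<tau> = "Transposition.transpose (length us) (Suc (length us))"
  show "f (us @ y # x # vs) = - f ?xs"
  proof (cases "?xs \<in> all_simplices S")
    case True
    have "?\<tau> permutes {..<length ?xs}" by (rule permutes_swap_id) auto
    then have "f (permute_list ?\<tau> ?xs) = of_int (sign ?\<tau>) * f ?xs"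
      using f True unfolding cochains_def by blast
    then show ?thesis by (simp add: permute_list_adjacent sign_swap_id)
  next
    case False
    moreover have "us @ y # x # vs \<notin> all_simplices S"
      using False all_simplices_mset_cong[OF S, of "us @ y # x # vs" ?xs] by simp
    ultimately show ?thesis using f by (simp add: cochains_def)
  qed
next
  assume "(\<forall>xs. xs \<notin> all_simplices S \<longrightarrow> f xs = 0) \<and>
    (\<forall>us x y vs. f (us @ y # x # vs) = - f (us @ x # y # vs))"
  then show "f \<in> cochains S" unfolding cochains_def using alternating_permute_list[of f] by blast
qed

lemma cochain_zero: "\<lbrakk>f \<in> cochains S; xs \<notin> all_simplices S\<rbrakk> \<Longrightarrow> f xs = 0"
  by (simp add: cochains_def)

lemma cochain_move_last:
  assumes "is_weighted_complex S" "f \<in> cochains S"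
  shows "f (us @ x # vs) = (-1) ^ length vs * f (us @ vs @ [x])"
proof (induction vs arbitrary: us)
  case (Cons v vs)
  have "f (us @ x # v # vs) = - f ((us @ [v]) @ x # vs)"
    using assms cochains_iff by (metis append.assoc append_Cons append_Nil)
  then show ?case using Cons.IH[of "us @ [v]"] by simp
qed simp


section \<open>The coboundary and its formal adjoint preserve cochains\<close>

abbreviation del :: "nat \<Rightarrow> 'a list \<Rightarrow> 'a list" where
  "del j xs \<equiv> take j xs @ drop (Suc j) xs"

text \<open>
  After a swap of the entries at positions \<open>k\<close> and \<open>k + 1\<close>, the faces opposite to these two entries
  are interchanged and meet opposite signs in the sum; every other face is itself changed by a swap
  of adjacent entries.
\<close>

lemma d_op_cochain:
  fixes S :: "'v weighted_complex"
  assumes S: "is_weighted_complex S" and f: "f \<in> cochains S"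
  shows "d_op S f \<in> cochains S"
  unfolding cochains_iff[OF S]
proof (intro conjI allI impI)
  show "d_op S f xs = 0" if "xs \<notin> all_simplices S" for xs using that by (simp add: d_op_def)
  fix us vs :: "'v list" and x y
  let ?xs = "us @ x # y # vs" and ?ys = "us @ y # x # vs" and ?k = "length us"
  let ?\<tau> = "Transposition.transpose ?k (Suc ?k)" and ?n = "length us + 2 + length vs"
  have alt: "f (us @ y # x # vs) = - f (us @ x # y # vs)" for us vs x y using f cochains_iff[OF S] by blast
  have \<tau>: "?\<tau> permutes {..<?n}" by (rule permutes_swap_id) auto
  have flip: "(-1) ^ j * f (del j ?ys) = - ((-1) ^ (?\<tau> j) * f (del (?\<tau> j) ?xs))" for j
  proof -
    consider "j < ?k" | "j = ?k" | "j = Suc ?k" | i where "j = ?k + 2 + i"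
      by (metis add_2_eq_Suc' less_antisym less_iff_Suc_add add_Suc_right add_Suc linorder_neqE_nat not_less_eq)
    then show ?thesis
    proof cases
      case 1
      have "del j (us @ zs) = del j us @ zs" for zs :: "'v list" using 1 by simp
      then show ?thesis using 1 alt[of "del j us" y x vs] by (simp add: Transposition.transpose_def)
    next
      case 4
      then have j: "j = Suc (Suc (?k + i))" by simp
      have "del j (us @ a # b # vs) = us @ a # b # del i vs" for a b :: 'v
        unfolding j by (simp add: numeral_3_eq_3)
      moreover have "?\<tau> j = j" unfolding j by (simp add: Transposition.transpose_def)
      ultimately show ?thesis using alt[of us y x "del i vs"]
        by (simp del: take_append drop_append)
    qed (simp_all add: Transposition.transpose_def)
  qed
  have mem: "?ys \<in> all_simplices S \<longleftrightarrow> ?xs \<in> all_simplices S"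
    by (rule all_simplices_mset_cong[OF S]) simp
  have "(\<Sum>j<?n. (-1) ^ j * f (del j ?ys)) = (\<Sum>j<?n. - ((-1) ^ (?\<tau> j) * f (del (?\<tau> j) ?xs)))"
    unfolding flip ..
  also have "\<dots> = - (\<Sum>j<?n. (-1) ^ j * f (del j ?xs))"
    unfolding sum_negf by (subst (2) sum.permute[OF \<tau>]) (simp add: o_def)
  finally show "d_op S f ?ys = - d_op S f ?xs"
    unfolding d_op_def mem by (simp del: take_append drop_append)
qed

lemma clique_insert:
  assumes "is_weighted_complex S" "x \<notin> A"
  shows "clique S (insert x A) \<longleftrightarrow> clique S A \<and> x \<in> vertices S \<and> (\<forall>y\<in>A. adjacent S y x)"
  using assms adjacent_sym[OF assms(1)] unfolding clique_def by auto

lemma snoc_simplex_iff: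
  assumes S: "is_weighted_complex S" and "xs \<noteq> []"
  shows "xs @ [x] \<in> all_simplices S \<longleftrightarrow>
    xs \<in> all_simplices S \<and> length xs < max_vertices S \<and> x \<in> common_neighbours S xs"
proof -
  have "x \<notin> set xs" if "x \<in> common_neighbours S xs"
    using that not_adjacent_refl[OF S] unfolding common_neighbours_def by blast
  then show ?thesis
    using assms(2) clique_insert[OF S, of x "set xs"] unfolding all_simplices_iff[OF S]
    by (auto simp: common_neighbours_def)
qed

lemma finite_common_neighbours:
  assumes "is_weighted_complex S" "locally_finite_complex S" "xs \<in> all_simplices S"
  shows "finite (common_neighbours S xs)"
proof -
  have "xs \<noteq> []" "set xs \<subseteq> vertices S" using assms by (auto simp: all_simplices_iff clique_def)
  then have "hd xs \<in> set xs" "hd xs \<in> vertices S" by auto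
  then show ?thesis
    using assms(2) unfolding locally_finite_complex_def common_neighbours_def
    by (auto intro: finite_subset[rotated])
qed

lemma delta_op_cochain:
  fixes S :: "'v weighted_complex"
  assumes S: "is_weighted_complex S" and g: "g \<in> cochains S"
  shows "delta_op S g \<in> cochains S"
  unfolding cochains_iff[OF S]
proof (intro conjI allI impI)
  show "delta_op S g xs = 0" if "xs \<notin> all_simplices S" for xs using that by (simp add: delta_op_def)
  fix us vs :: "'v list" and x y
  let ?xs = "us @ x # y # vs" and ?ys = "us @ y # x # vs"
  have mem: "?ys \<in> all_simplices S \<longleftrightarrow> ?xs \<in> all_simplices S"
    by (rule all_simplices_mset_cong[OF S]) simp
  have cn: "common_neighbours S ?ys = common_neighbours S ?xs"
    by (auto simp: common_neighbours_def)
  show "delta_op S g ?ys = - delta_op S g ?xs"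
  proof (cases "?xs \<in> all_simplices S \<and> length ?xs < max_vertices S")
    case True
    have "of_real (weight S (?ys @ [z])) * g (?ys @ [z]) = - (of_real (weight S (?xs @ [z])) * g (?xs @ [z]))"
      if "z \<in> common_neighbours S ?xs" for z
    proof -
      have "?xs @ [z] \<in> all_simplices S" using True that by (subst snoc_simplex_iff[OF S]) auto
      then have "weight S (?ys @ [z]) = weight S (?xs @ [z])"
        by (intro weight_mset_cong[OF S]) auto
      moreover have "g (?ys @ [z]) = - g (?xs @ [z])"
      proof -
        have "g (us @ y # x # (vs @ [z])) = - g (us @ x # y # (vs @ [z]))" using g cochains_iff[OF S] by blast
        then show ?thesis by simp
      qed
      ultimately show ?thesis by simp
    qed
    moreover have "weight S ?ys = weight S ?xs" using True by (intro weight_mset_cong[OF S]) auto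
    ultimately show ?thesis
      using True unfolding delta_op_def mem cn by (simp add: sum_negf)
  next
    case False
    then show ?thesis unfolding delta_op_def mem by auto
  qed
qed

lemma finite_support_delta_op:
  assumes "finite {xs. g xs \<noteq> 0}" shows "finite {xs. delta_op S g xs \<noteq> 0}"
proof (rule finite_subset)
  show "{xs. delta_op S g xs \<noteq> 0} \<subseteq> butlast ` {xs. g xs \<noteq> 0}"
  proof
    fix xs assume "xs \<in> {xs. delta_op S g xs \<noteq> 0}"
    then have "(\<Sum>x\<in>common_neighbours S xs. of_real (weight S (xs @ [x])) * g (xs @ [x])) \<noteq> 0"
      by (auto simp: delta_op_def split: if_splits)
    then obtain x where "of_real (weight S (xs @ [x])) * g (xs @ [x]) \<noteq> 0"
      by (rule sum.not_neutral_contains_not_neutral)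
    then have "g (xs @ [x]) \<noteq> 0" by simp
    then show "xs \<in> butlast ` {xs. g xs \<noteq> 0}" by (intro image_eqI[of _ _ "xs @ [x]"]) auto
  qed
qed (use assms in simp)

text \<open>
  A simplex on which \<open>d f\<close> does not vanish arises from one in the support of \<open>f\<close> by inserting a common
  neighbour of its vertices, and by local finiteness there are finitely many ways to do so.
\<close>

lemma finite_support_d_op:
  assumes S: "is_weighted_complex S" and lf: "locally_finite_complex S" and f: "f \<in> cochains S"
    and fin: "finite {xs. f xs \<noteq> 0}"
  shows "finite {xs. d_op S f xs \<noteq> 0}"
proof (rule finite_subset)
  let ?N = "\<lambda>ys. (\<lambda>(j, x). take j ys @ x # drop j ys) ` ({..length ys} \<times> common_neighbours S ys)"
  show "finite (\<Union>ys\<in>{ys. f ys \<noteq> 0}. ?N ys)"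
    using fin f by (auto intro!: finite_common_neighbours[OF S lf] simp: cochains_def)
  show "{xs. d_op S f xs \<noteq> 0} \<subseteq> (\<Union>ys\<in>{ys. f ys \<noteq> 0}. ?N ys)"
  proof
    fix xs assume "xs \<in> {xs. d_op S f xs \<noteq> 0}"
    then have xs: "xs \<in> all_simplices S" and sum: "(\<Sum>j<length xs. (-1) ^ j * f (del j xs)) \<noteq> 0"
      by (auto simp: d_op_def split: if_splits)
    from sum obtain j where "j \<in> {..<length xs}" "(-1) ^ j * f (del j xs) \<noteq> 0"
      by (rule sum.not_neutral_contains_not_neutral)
    then have j: "j < length xs" "f (del j xs) \<noteq> 0" by simp_all
    have split: "xs = take j xs @ xs ! j # drop (Suc j) xs" using j(1) by (rule id_take_nth_drop)
    have "del j xs @ [xs ! j] \<in> all_simplices S"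
      using xs by (subst all_simplices_mset_cong[OF S, of _ xs]) (subst (4) split, simp)
    moreover have "del j xs \<noteq> []"
      using j(2) f cochain_zero[of f S "del j xs"] all_simplices_iff[OF S, of "del j xs"] by blast
    ultimately have "xs ! j \<in> common_neighbours S (del j xs)" using snoc_simplex_iff[OF S] by blast
    moreover have "j \<le> length (del j xs)" using j(1) by simp
    ultimately have "(j, xs ! j) \<in> {..length (del j xs)} \<times> common_neighbours S (del j xs)" by blast
    then have "(\<lambda>(i, x). take i (del j xs) @ x # drop i (del j xs)) (j, xs ! j) \<in> ?N (del j xs)"
      by (rule imageI)
    moreover have "take j (del j xs) @ xs ! j # drop j (del j xs) = xs" using j(1) split by simp
    ultimately have "xs \<in> ?N (del j xs)" unfolding prod.case by (simp only:)
    then show "xs \<in> (\<Union>ys\<in>{ys. f ys \<noteq> 0}. ?N ys)" using j(2) by blast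
  qed
qed

lemma fin_cochains_ops:
  assumes "is_weighted_complex S" "locally_finite_complex S" "f \<in> fin_cochains S"
  shows "d_op S f \<in> fin_cochains S" "delta_op S f \<in> fin_cochains S" "gauss_bonnet S f \<in> fin_cochains S"
proof -
  show d: "d_op S f \<in> fin_cochains S" and \<delta>: "delta_op S f \<in> fin_cochains S"
    using assms d_op_cochain delta_op_cochain finite_support_d_op finite_support_delta_op
    unfolding fin_cochains_def by auto
  have "gauss_bonnet S f = d_op S f + delta_op S f" by (simp add: gauss_bonnet_def plus_fun_def)
  then have "gauss_bonnet S f \<in> cochains S"
    using d \<delta> cochains_closed(2) unfolding fin_cochains_def by fastforce
  moreover have "finite {xs. gauss_bonnet S f xs \<noteq> 0}"
    by (rule finite_subset[of _ "{xs. d_op S f xs \<noteq> 0} \<union> {xs. delta_op S f xs \<noteq> 0}"])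
      (use d \<delta> in \<open>auto simp: gauss_bonnet_def fin_cochains_def\<close>)
  ultimately show "gauss_bonnet S f \<in> fin_cochains S" by (simp add: fin_cochains_def)
qed

section \<open>Inner products as finite sums\<close>

definition simplices_over :: "'v weighted_complex \<Rightarrow> 'v set \<Rightarrow> 'v list set" where
  "simplices_over S F = {xs \<in> all_simplices S. set xs \<subseteq> F}"

definition support_vertices :: "'v cochain \<Rightarrow> 'v set" where
  "support_vertices f = \<Union> (set ` {xs. f xs \<noteq> 0})"

lemma finite_support_vertices: "f \<in> fin_cochains S \<Longrightarrow> finite (support_vertices f)"
  by (simp add: fin_cochains_def support_vertices_def)

lemma support_vertices_subset: "f xs \<noteq> 0 \<Longrightarrow> set xs \<subseteq> support_vertices f"
  by (auto simp: support_vertices_def)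

lemma finite_simplices_over:
  assumes "is_weighted_complex S" "finite F" shows "finite (simplices_over S F)"
  by (rule finite_subset[OF _ finite_lists_length_le[OF assms(2), of "max_vertices S"]])
    (auto simp: simplices_over_def all_simplices_iff[OF assms(1)])

lemma sq_summable_finite: "finite {xs. f xs \<noteq> 0} \<Longrightarrow> sq_summable X w f"
  unfolding sq_summable_def
  by (rule finite_nonzero_values_imp_summable_on) (auto elim!: rev_finite_subset)

lemma fin_cochains_l2: "f \<in> fin_cochains S \<Longrightarrow> f \<in> l2_cochains S"
  by (simp add: fin_cochains_def l2_cochains_iff sq_summable_finite)

lemma l2_inner_finite:
  assumes S: "is_weighted_complex S" and f: "f \<in> l2_cochains S" and g: "g \<in> l2_cochains S"
    and F: "finite F" "support_vertices f \<subseteq> F \<or> support_vertices g \<subseteq> F"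
  shows "l2_inner S f g = (\<Sum>xs\<in>simplices_over S F. of_real (simplex_weight S xs) * cnj (f xs) * g xs)"
proof -
  have "cnj (f xs) * g xs = 0" if "xs \<in> all_simplices S - simplices_over S F" for xs
    using that F(2) support_vertices_subset[of f xs] support_vertices_subset[of g xs]
    unfolding simplices_over_def by auto
  then have "(\<Sum>\<^sub>\<infinity>xs\<in>all_simplices S. of_real (simplex_weight S xs) * cnj (f xs) * g xs)
      = (\<Sum>\<^sub>\<infinity>xs\<in>simplices_over S F. of_real (simplex_weight S xs) * cnj (f xs) * g xs)"
    by (intro infsum_cong_neutral) (auto simp: simplices_over_def)
  then show ?thesis using finite_simplices_over[OF S F(1)] by (simp add: l2_inner_eq[OF S f g])
qed

lemma l2_norm_finite:
  assumes S: "is_weighted_complex S" and f: "f \<in> l2_cochains S"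
    and F: "finite F" "support_vertices f \<subseteq> F"
  shows "(l2_norm S f)\<^sup>2 = (\<Sum>xs\<in>simplices_over S F. simplex_weight S xs * (cmod (f xs))\<^sup>2)"
proof -
  have "0 \<le> simplex_weight S xs" if "xs \<in> simplices_over S F" for xs
    using that simplex_weight_pos[OF S] by (auto simp: simplices_over_def less_imp_le)
  then have pos: "0 \<le> (\<Sum>xs\<in>simplices_over S F. simplex_weight S xs * (cmod (f xs))\<^sup>2)"
    by (intro sum_nonneg) simp
  have "l2_inner S f f = of_real (\<Sum>xs\<in>simplices_over S F. simplex_weight S xs * (cmod (f xs))\<^sup>2)"
    unfolding l2_inner_finite[OF S f f F(1) disjI1[OF F(2)]] of_real_sum
    by (simp only: of_real_mult complex_norm_square mult_ac)
  then show ?thesis using pos by (simp add: l2_norm_def)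
qed

text \<open>
  A simplex with at least two vertices is a face together with a last vertex. Both the adjointness of
  \<open>d\<close> and \<open>\<delta>\<close> and the norm bound for \<open>\<delta>\<close> rearrange their sums in this way.
\<close>

lemma sum_snoc_simplices:
  fixes h :: "'v list \<Rightarrow> 'b::comm_monoid_add"
  assumes S: "is_weighted_complex S" and F: "finite F"
  shows "(\<Sum>ys\<in>simplices_over S F. \<Sum>x\<in>{x\<in>F. ys @ [x] \<in> all_simplices S}. h (ys @ [x]))
    = (\<Sum>zs\<in>{zs\<in>simplices_over S F. 2 \<le> length zs}. h zs)"
proof -
  let ?A = "\<lambda>ys. {x\<in>F. ys @ [x] \<in> all_simplices S}" and ?Z = "{zs\<in>simplices_over S F. 2 \<le> length zs}"
  have "(\<Sum>ys\<in>simplices_over S F. \<Sum>x\<in>?A ys. h (ys @ [x])) =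
      (\<Sum>(ys, x)\<in>Sigma (simplices_over S F) ?A. h (ys @ [x]))"
    by (rule sum.Sigma) (use F finite_simplices_over[OF S F] in auto)
  also have "\<dots> = (\<Sum>zs\<in>?Z. h zs)"
  proof (rule sum.reindex_bij_witness[of _ "\<lambda>zs. (butlast zs, last zs)" "\<lambda>(ys, x). ys @ [x]"])
    fix zs assume zs: "zs \<in> ?Z"
    then have eq: "butlast zs @ [last zs] = zs" by (intro append_butlast_last_id) auto
    then show "(case (butlast zs, last zs) of (ys, x) \<Rightarrow> ys @ [x]) = zs" by simp
    have ne: "butlast zs \<noteq> []" using zs by (cases zs) auto
    have zs': "zs \<in> all_simplices S" "set zs \<subseteq> F" using zs by (auto simp: simplices_over_def)
    have "butlast zs \<in> all_simplices S" using snoc_simplex_iff[OF S ne, of "last zs"] zs' unfolding eq by blast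
    moreover have "set (butlast zs) \<subseteq> F" "last zs \<in> F"
      using zs'(2) by (metis eq le_sup_iff set_append, metis eq in_set_conv_decomp subsetD)
    ultimately show "(butlast zs, last zs) \<in> Sigma (simplices_over S F) ?A"
      using zs' eq by (simp add: simplices_over_def)
  next
    fix a assume "a \<in> Sigma (simplices_over S F) ?A"
    then obtain ys x where a: "a = (ys, x)" "ys \<in> simplices_over S F" "x \<in> F" "ys @ [x] \<in> all_simplices S" by auto
    then have "ys \<noteq> []" by (auto simp: simplices_over_def all_simplices_iff[OF S])
    then show "(case a of (ys, x) \<Rightarrow> ys @ [x]) \<in> ?Z"
      using a by (cases ys) (auto simp: simplices_over_def)
  qed auto
  finally show ?thesis .
qed

text \<open>
  Replacing the common neighbours by the vertices in a fixed finite set \<open>F\<close> makes all sums finite sums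
  over \<open>simplices_over S F\<close>. If \<open>ys\<close> already has the maximal number of vertices, the sum is empty.
\<close>

lemma delta_op_eq:
  assumes S: "is_weighted_complex S" and lf: "locally_finite_complex S"
    and g: "g \<in> cochains S" and F: "finite F" "support_vertices g \<subseteq> F" and ys: "ys \<in> all_simplices S"
  shows "delta_op S g ys = (-1) ^ length ys / of_real (weight S ys) *
    (\<Sum>x\<in>{x\<in>F. ys @ [x] \<in> all_simplices S}. of_real (weight S (ys @ [x])) * g (ys @ [x]))"
proof -
  have ne: "ys \<noteq> []" using ys by (auto simp: all_simplices_iff[OF S])
  note snoc = snoc_simplex_iff[OF S ne]
  show ?thesis
  proof (cases "length ys < max_vertices S")
    case True
    have "(\<Sum>x\<in>common_neighbours S ys. of_real (weight S (ys @ [x])) * g (ys @ [x])) =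
      (\<Sum>x\<in>{x\<in>F. ys @ [x] \<in> all_simplices S}. of_real (weight S (ys @ [x])) * g (ys @ [x]))"
    proof (rule sum.mono_neutral_right[OF finite_common_neighbours[OF S lf ys]])
      show "\<forall>x\<in>common_neighbours S ys - {x \<in> F. ys @ [x] \<in> all_simplices S}.
          of_real (weight S (ys @ [x])) * g (ys @ [x]) = 0"
        using support_vertices_subset[of g] F(2) g cochain_zero by fastforce
    qed (auto simp: snoc)
    then show ?thesis using True ys by (simp add: delta_op_def)
  next
    case False
    then have "{x\<in>F. ys @ [x] \<in> all_simplices S} = {}" by (auto simp: snoc)
    then show ?thesis using False by (simp add: delta_op_def del: Collect_empty_eq)
  qed
qed

section \<open>Symmetry of the Gauss--Bonnet operator\<close>

text \<open>
  Each of the \<open>length xs\<close> faces in the sum for \<open>d f xs\<close> contributes the same amount after summation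
  over \<open>xs\<close>: moving the deleted entry to the end of \<open>xs\<close> permutes the simplices, and the sign from
  the alternation of \<open>g\<close> cancels the dependence on the position. The factor \<open>length xs\<close> turns
  \<open>1 / (length xs)!\<close> into the factorial that belongs to the face.
\<close>

lemma d_delta_adjoint:
  assumes S: "is_weighted_complex S" and lf: "locally_finite_complex S"
    and f: "f \<in> fin_cochains S" and g: "g \<in> fin_cochains S"
  shows "l2_inner S (d_op S f) g = l2_inner S f (delta_op S g)"
proof -
  define F where "F = support_vertices f \<union> support_vertices g"
  have F: "finite F" "support_vertices f \<subseteq> F" "support_vertices g \<subseteq> F"
    using f g finite_support_vertices by (auto simp: F_def)
  let ?Y = "simplices_over S F" and ?w = "simplex_weight S"
  let ?Z = "{zs\<in>?Y. 2 \<le> length zs}"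
  have Y: "finite ?Y" by (rule finite_simplices_over[OF S F(1)])
  have fc: "f \<in> cochains S" and gc: "g \<in> cochains S" using f g by (auto simp: fin_cochains_def)
  note l2 = fin_cochains_l2[OF f] fin_cochains_l2[OF g] fin_cochains_l2[OF fin_cochains_ops(1)[OF S lf f]]
    fin_cochains_l2[OF fin_cochains_ops(2)[OF S lf g]]
  define h where "h zs = (-1) ^ (length zs - 1) * of_real (?w zs) * cnj (f (butlast zs)) * g zs" for zs
  have mem: "xs \<in> all_simplices S" if "xs \<in> ?Y" for xs using that by (simp add: simplices_over_def)
  have "l2_inner S (d_op S f) g = (\<Sum>xs\<in>?Y. of_real (?w xs) * cnj (d_op S f xs) * g xs)"
    by (rule l2_inner_finite) (use S l2 F in auto)
  also have "\<dots> = (\<Sum>xs\<in>?Z. of_real (?w xs) * cnj (d_op S f xs) * g xs)"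
    by (rule sum.mono_neutral_right[OF Y]) (auto simp: d_op_def)
  also have "\<dots> = (\<Sum>xs\<in>?Z. \<Sum>j<length xs. of_real (?w xs) * ((-1) ^ j * cnj (f (del j xs))) * g xs)"
    by (rule sum.cong[OF refl]) (auto simp: d_op_def mem sum_distrib_left sum_distrib_right)
  also have "\<dots> = (\<Sum>(xs, j)\<in>(SIGMA xs:?Z. {..<length xs}). of_real (?w xs) * ((-1) ^ j * cnj (f (del j xs))) * g xs)"
    by (rule sum.Sigma) (use Y in auto)
  also have "\<dots> = (\<Sum>(zs, j)\<in>(SIGMA xs:?Z. {..<length xs}). h zs)"
  proof (rule sum.reindex_bij_witness[of _
        "\<lambda>(zs, j). (take j (butlast zs) @ last zs # drop j (butlast zs), j)"
        "\<lambda>(xs, j). (del j xs @ [xs ! j], j)"])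
    fix a assume "a \<in> (SIGMA xs:?Z. {..<length xs})"
    then obtain xs j where a: "a = (xs, j)" "xs \<in> ?Z" "j < length xs" by auto
    have split: "take j xs @ xs ! j # drop (Suc j) xs = xs" using a(3) by (simp add: id_take_nth_drop[symmetric])
    let ?zs = "del j xs @ [xs ! j]"
    have "mset ?zs = mset (take j xs @ xs ! j # drop (Suc j) xs)" by (simp del: append_take_drop_id)
    then have ms: "mset ?zs = mset xs" unfolding split .
    have len: "length ?zs = length xs" by (metis ms size_mset)
    have set: "set ?zs = set xs" by (metis ms set_mset_mset)
    have zs: "?zs \<in> ?Z"
      using a(2) unfolding simplices_over_def mem_Collect_eq len set all_simplices_mset_cong[OF S ms] .
    then show "(case a of (xs, j) \<Rightarrow> (del j xs @ [xs ! j], j)) \<in> (SIGMA xs:?Z. {..<length xs})"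
      using a(1,3) len by simp
    show "(case case a of (xs, j) \<Rightarrow> (del j xs @ [xs ! j], j) of (zs, j) \<Rightarrow>
        (take j (butlast zs) @ last zs # drop j (butlast zs), j)) = a"
      using a(1,3) split by (simp add: butlast_append)
    have "g xs = (-1) ^ (length xs - Suc j) * g ?zs"
      using cochain_move_last[OF S gc, of "take j xs" "xs ! j" "drop (Suc j) xs"] unfolding split by simp
    moreover have "?w ?zs = ?w xs"
      unfolding simplex_weight_def len using weight_mset_cong[OF S ms] a(2) mem by simp
    moreover have "(-1) ^ j * (-1) ^ (length xs - Suc j) = ((-1) ^ (length xs - 1) :: complex)"
      using a(3) by (simp add: power_add[symmetric])
    ultimately show "(case case a of (xs, j) \<Rightarrow> (del j xs @ [xs ! j], j) of (zs, j) \<Rightarrow> h zs) =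
        (case a of (xs, j) \<Rightarrow> of_real (?w xs) * ((-1) ^ j * cnj (f (del j xs))) * g xs)"
      unfolding a(1) prod.case h_def len butlast_snoc by (simp add: mult_ac)
  next
    fix b assume "b \<in> (SIGMA xs:?Z. {..<length xs})"
    then obtain zs j where b: "b = (zs, j)" "zs \<in> ?Z" "j < length zs" by auto
    have ne: "zs \<noteq> []" using b(3) by auto
    have eq: "butlast zs @ [last zs] = zs" using ne by simp
    have jl: "j \<le> length (butlast zs)" using b(3) by simp
    let ?xs = "take j (butlast zs) @ last zs # drop j (butlast zs)"
    have "mset ?xs = mset (butlast zs @ [last zs])"
      by (simp del: append_butlast_last_id) (metis append_take_drop_id mset_append)
    then have ms: "mset ?xs = mset zs" unfolding eq .
    have len: "length ?xs = length zs" by (metis ms size_mset)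
    have set: "set ?xs = set zs" by (metis ms set_mset_mset)
    have "?xs \<in> ?Z"
      using b(2) unfolding simplices_over_def mem_Collect_eq len set all_simplices_mset_cong[OF S ms] .
    then show "(case b of (zs, j) \<Rightarrow> (take j (butlast zs) @ last zs # drop j (butlast zs), j))
        \<in> (SIGMA xs:?Z. {..<length xs})"
      using b(1,3) len by simp
    have "del j ?xs = butlast zs" "?xs ! j = last zs" using jl by (auto simp: nth_append)
    then show "(case case b of (zs, j) \<Rightarrow> (take j (butlast zs) @ last zs # drop j (butlast zs), j) of
        (xs, j) \<Rightarrow> (del j xs @ [xs ! j], j)) = b"
      unfolding b(1) prod.case using eq by simp
  qed
  also have "\<dots> = (\<Sum>zs\<in>?Z. of_nat (length zs) * h zs)"
    by (subst sum.Sigma[symmetric]) (use Y in auto)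
  also have "\<dots> = (\<Sum>ys\<in>?Y. \<Sum>x\<in>{x\<in>F. ys @ [x] \<in> all_simplices S}. of_nat (length (ys @ [x])) * h (ys @ [x]))"
    by (rule sum_snoc_simplices[OF S F(1), symmetric])
  also have "\<dots> = (\<Sum>ys\<in>?Y. of_real (?w ys) * cnj (f ys) * delta_op S g ys)"
  proof (rule sum.cong[OF refl])
    fix ys assume ys: "ys \<in> ?Y"
    let ?A = "{x\<in>F. ys @ [x] \<in> all_simplices S}"
    have hx: "of_nat (length (ys @ [x])) * h (ys @ [x]) =
        (-1) ^ length ys / fact (length ys) * cnj (f ys) * (of_real (weight S (ys @ [x])) * g (ys @ [x]))" for x
    proof -
      have "of_nat (length (ys @ [x])) * complex_of_real (?w (ys @ [x])) = of_real (weight S (ys @ [x])) / fact (length ys)"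
        by (simp add: simplex_weight_def field_simps del: of_nat_Suc)
      then show ?thesis by (simp add: h_def field_simps del: of_nat_Suc)
    qed
    have quot: "of_real (?w ys) * ((-1) ^ length ys / of_real (weight S ys)) =
        ((-1) ^ length ys / fact (length ys) :: complex)"
      using weight_pos[OF S mem[OF ys]] by (simp add: simplex_weight_def)
    show "(\<Sum>x\<in>?A. of_nat (length (ys @ [x])) * h (ys @ [x])) =
        of_real (?w ys) * cnj (f ys) * delta_op S g ys"
      unfolding delta_op_eq[OF S lf gc F(1,3) mem[OF ys]] sum_distrib_left hx
      by (simp only: quot[symmetric] mult_ac)
  qed
  also have "\<dots> = l2_inner S f (delta_op S g)"
    by (rule l2_inner_finite[symmetric]) (use S l2 F in auto)
  finally show ?thesis .
qed

lemma fin_cochains_closed: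
  "0 \<in> fin_cochains S"
  "\<lbrakk>f \<in> fin_cochains S; g \<in> fin_cochains S\<rbrakk> \<Longrightarrow> f + g \<in> fin_cochains S"
  "f \<in> fin_cochains S \<Longrightarrow> scale_cochain c f \<in> fin_cochains S"
proof -
  assume f: "f \<in> fin_cochains S"
  show "scale_cochain c f \<in> fin_cochains S"
    using f cochains_closed(3) unfolding fin_cochains_def by (auto elim!: rev_finite_subset)
  assume g: "g \<in> fin_cochains S"
  have "finite {xs. (f + g) xs \<noteq> 0}"
    by (rule finite_subset[of _ "{xs. f xs \<noteq> 0} \<union> {xs. g xs \<noteq> 0}"]) (use f g in \<open>auto simp: fin_cochains_def\<close>)
  then show "f + g \<in> fin_cochains S" using f g cochains_closed(2) unfolding fin_cochains_def by blast
qed (simp add: fin_cochains_def cochains_closed)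

lemma gauss_bonnet_linear:
  "gauss_bonnet S (f + g) = gauss_bonnet S f + gauss_bonnet S g"
  "gauss_bonnet S (scale_cochain c f) = scale_cochain c (gauss_bonnet S f)"
  by (auto simp: fun_eq_iff gauss_bonnet_def d_op_def delta_op_def sum.distrib sum_distrib_left algebra_simps)

lemma symmetric_gauss_bonnet:
  assumes S: "is_weighted_complex S" and lf: "locally_finite_complex S"
  shows "complex_hilbert_space.symmetric_operator scale_cochain (l2_cochains S) (l2_inner S)
    (fin_cochains S) (gauss_bonnet S)"
proof -
  interpret complex_hilbert_space scale_cochain "l2_cochains S" "l2_inner S" "l2_norm S"
    by (rule complex_hilbert_space_l2_cochains[OF S])
  have "gauss_bonnet S ` fin_cochains S \<subseteq> l2_cochains S"
    using fin_cochains_ops(3)[OF S lf] fin_cochains_l2 by blast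
  moreover have "subspace (fin_cochains S)" by (intro subspaceI fin_cochains_closed)
  moreover have "fin_cochains S \<subseteq> l2_cochains S" using fin_cochains_l2 by blast
  ultimately have lin: "linear_operator (fin_cochains S) (gauss_bonnet S)"
    by (simp add: linear_operator_def gauss_bonnet_linear)
  have eq: "gauss_bonnet S u = d_op S u + delta_op S u" for u by (simp add: gauss_bonnet_def plus_fun_def)
  have "l2_inner S (gauss_bonnet S u) v = l2_inner S u (gauss_bonnet S v)"
    if u: "u \<in> fin_cochains S" and v: "v \<in> fin_cochains S" for u v
  proof -
    note H = fin_cochains_l2[OF u] fin_cochains_l2[OF v]
      fin_cochains_ops(1,2)[OF S lf u, THEN fin_cochains_l2] fin_cochains_ops(1,2)[OF S lf v, THEN fin_cochains_l2]
    have "l2_inner S (delta_op S u) v = cnj (l2_inner S v (delta_op S u))"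
      by (rule ip_commute) (use H in auto)
    also have "\<dots> = cnj (l2_inner S (d_op S v) u)" by (simp add: d_delta_adjoint[OF S lf v u])
    also have "\<dots> = l2_inner S u (d_op S v)" by (rule ip_commute[symmetric]) (use H in auto)
    finally have "l2_inner S (delta_op S u) v = l2_inner S u (d_op S v)" .
    then show ?thesis using d_delta_adjoint[OF S lf u v] H by (simp add: eq ip_linear)
  qed
  then show ?thesis using lin by (simp add: symmetric_operator_def)
qed

section \<open>Boundedness of the Gauss--Bonnet operator\<close>

text \<open>
  By Cauchy--Schwarz, the square of the sum over the common neighbours of \<open>ys\<close> is at most the degree
  of \<open>ys\<close> times \<open>weight S ys\<close> times the weighted sum of the squares. The factor \<open>max_vertices S\<close>
  accounts for the different factorials in the norms of two consecutive degrees.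
\<close>

lemma l2_norm_delta_op_le:
  assumes S: "is_weighted_complex S" and lf: "locally_finite_complex S"
    and K: "\<And>i xs. \<lbrakk>i \<le> max_vertices S - 2; xs \<in> simplices S i\<rbrakk> \<Longrightarrow> weighted_degree S xs \<le> K" "0 \<le> K"
    and g: "g \<in> fin_cochains S"
  shows "l2_norm S (delta_op S g) \<le> sqrt (real (max_vertices S) * K) * l2_norm S g"
proof (rule power2_le_imp_le)
  interpret complex_hilbert_space scale_cochain "l2_cochains S" "l2_inner S" "l2_norm S"
    by (rule complex_hilbert_space_l2_cochains[OF S])
  note \<delta> = fin_cochains_ops(2)[OF S lf g]
  define F where "F = support_vertices g \<union> support_vertices (delta_op S g)"
  have F: "finite F" "support_vertices g \<subseteq> F" "support_vertices (delta_op S g) \<subseteq> F"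
    using g \<delta> finite_support_vertices by (auto simp: F_def)
  have gc: "g \<in> cochains S" using g by (simp add: fin_cochains_def)
  let ?Y = "simplices_over S F" and ?w = "simplex_weight S" and ?n = "max_vertices S"
  let ?A = "\<lambda>ys. {x\<in>F. ys @ [x] \<in> all_simplices S}"
  have Y: "finite ?Y" by (rule finite_simplices_over[OF S F(1)])
  have mem: "xs \<in> all_simplices S" if "xs \<in> ?Y" for xs using that by (simp add: simplices_over_def)
  have "(l2_norm S (delta_op S g))\<^sup>2 = (\<Sum>ys\<in>?Y. ?w ys * (cmod (delta_op S g ys))\<^sup>2)"
    by (rule l2_norm_finite) (use S \<delta> fin_cochains_l2 F in auto)
  also have "\<dots> \<le> (\<Sum>ys\<in>?Y. \<Sum>x\<in>?A ys. K * (length (ys @ [x]) * (?w (ys @ [x]) * (cmod (g (ys @ [x])))\<^sup>2)))"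
  proof (rule sum_mono)
    fix ys assume ys: "ys \<in> ?Y"
    have ne: "ys \<noteq> []" using mem[OF ys] by (auto simp: all_simplices_iff[OF S])
    let ?m = "\<lambda>x. weight S (ys @ [x])" and ?g = "\<lambda>x. cmod (g (ys @ [x]))" and ?M = "weight S ys"
    have m: "0 < ?m x" if "x \<in> ?A ys" for x using that weight_pos[OF S] by auto
    have M: "0 < ?M" using mem[OF ys] weight_pos[OF S] by auto
    have "(cmod (\<Sum>x\<in>?A ys. of_real (?m x) * g (ys @ [x])))\<^sup>2 \<le> (\<Sum>x\<in>?A ys. ?m x * ?g x)\<^sup>2"
    proof (rule power_mono)
      show "cmod (\<Sum>x\<in>?A ys. of_real (?m x) * g (ys @ [x])) \<le> (\<Sum>x\<in>?A ys. ?m x * ?g x)"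
        by (rule sum_norm_le) (use m in \<open>simp add: norm_mult less_imp_le\<close>)
    qed simp
    also have "(\<Sum>x\<in>?A ys. ?m x * ?g x) = (\<Sum>x\<in>?A ys. sqrt (?m x) * (sqrt (?m x) * ?g x))"
      by (rule sum.cong[OF refl]) (use m in \<open>simp add: less_imp_le flip: mult.assoc\<close>)
    also have "\<dots>\<^sup>2 \<le> (\<Sum>x\<in>?A ys. (sqrt (?m x))\<^sup>2) * (\<Sum>x\<in>?A ys. (sqrt (?m x) * ?g x)\<^sup>2)"
      by (rule Cauchy_Schwarz_ineq_sum)
    also have "(\<Sum>x\<in>?A ys. (sqrt (?m x))\<^sup>2) = (\<Sum>x\<in>?A ys. ?m x)"
      by (rule sum.cong[OF refl]) (use m in \<open>simp add: less_imp_le\<close>)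
    also have "(\<Sum>x\<in>?A ys. (sqrt (?m x) * ?g x)\<^sup>2) = (\<Sum>x\<in>?A ys. ?m x * (?g x)\<^sup>2)"
      by (rule sum.cong[OF refl]) (use m in \<open>simp add: less_imp_le power_mult_distrib\<close>)
    also have "(\<Sum>x\<in>?A ys. ?m x) * (\<Sum>x\<in>?A ys. ?m x * (?g x)\<^sup>2) \<le> (K * ?M) * (\<Sum>x\<in>?A ys. ?m x * (?g x)\<^sup>2)"
    proof (rule mult_right_mono)
      show "0 \<le> (\<Sum>x\<in>?A ys. ?m x * (?g x)\<^sup>2)" by (rule sum_nonneg) (use m in \<open>simp add: less_imp_le\<close>)
      show "(\<Sum>x\<in>?A ys. ?m x) \<le> K * ?M"
      proof (cases "length ys < ?n")
        case True
        have cn: "?m x > 0" if "x \<in> common_neighbours S ys" for x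
          using that True mem[OF ys] snoc_simplex_iff[OF S ne] weight_pos[OF S] by blast
        have "(\<Sum>x\<in>?A ys. ?m x) \<le> (\<Sum>x\<in>common_neighbours S ys. ?m x)"
          by (rule sum_mono2[OF finite_common_neighbours[OF S lf mem[OF ys]]])
            (use snoc_simplex_iff[OF S ne] cn in \<open>auto simp: less_imp_le\<close>)
        also have "\<dots> = weighted_degree S ys * ?M" using M by (simp add: weighted_degree_def)
        also have "\<dots> \<le> K * ?M"
        proof (rule mult_right_mono)
          have "ys \<in> simplices S (length ys - 1)"
            using mem[OF ys] ne by (simp add: all_simplices_iff[OF S] simplices_iff[OF S])
          then show "weighted_degree S ys \<le> K" using True K(1)[of "length ys - 1" ys] by simp
        qed (use M in simp)
        finally show ?thesis .
      next
        case False
        then have "?A ys = {}" using snoc_simplex_iff[OF S ne] by blast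
        then show ?thesis using K(2) M by (simp only: sum.empty) simp
      qed
    qed
    finally have le: "(cmod (\<Sum>x\<in>?A ys. of_real (?m x) * g (ys @ [x])))\<^sup>2 \<le> (K * ?M) * (\<Sum>x\<in>?A ys. ?m x * (?g x)\<^sup>2)" .
    have "?w ys * (cmod (delta_op S g ys))\<^sup>2 =
        ?w ys * ((1 / ?M)\<^sup>2 * (cmod (\<Sum>x\<in>?A ys. of_real (?m x) * g (ys @ [x])))\<^sup>2)"
      unfolding delta_op_eq[OF S lf gc F(1,2) mem[OF ys]]
      using M by (simp add: norm_mult norm_divide norm_power power_mult_distrib power_divide)
    also have "\<dots> \<le> ?w ys * ((1 / ?M)\<^sup>2 * ((K * ?M) * (\<Sum>x\<in>?A ys. ?m x * (?g x)\<^sup>2)))"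
      using simplex_weight_pos[OF S mem[OF ys]] by (intro mult_left_mono le) auto
    also have "\<dots> = K / fact (length ys) * (\<Sum>x\<in>?A ys. ?m x * (?g x)\<^sup>2)"
      using M by (simp add: simplex_weight_def power2_eq_square)
    also have "\<dots> = (\<Sum>x\<in>?A ys. K * (length (ys @ [x]) * (?w (ys @ [x]) * (?g x)\<^sup>2)))"
      unfolding sum_distrib_left
      by (rule sum.cong[OF refl]) (simp add: simplex_weight_def del: of_nat_Suc)
    finally show "?w ys * (cmod (delta_op S g ys))\<^sup>2 \<le> (\<Sum>x\<in>?A ys. K * (length (ys @ [x]) * (?w (ys @ [x]) * (?g x)\<^sup>2)))" .
  qed
  also have "\<dots> = (\<Sum>zs\<in>{zs\<in>?Y. 2 \<le> length zs}. K * (length zs * (?w zs * (cmod (g zs))\<^sup>2)))"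
    by (rule sum_snoc_simplices[OF S F(1)])
  also have "\<dots> \<le> (\<Sum>zs\<in>?Y. K * (?n * (?w zs * (cmod (g zs))\<^sup>2)))"
  proof -
    have w: "0 \<le> ?w zs * (cmod (g zs))\<^sup>2" if "zs \<in> ?Y" for zs
      using simplex_weight_pos[OF S mem[OF that]] by simp
    have "(\<Sum>zs\<in>{zs\<in>?Y. 2 \<le> length zs}. K * (length zs * (?w zs * (cmod (g zs))\<^sup>2)))
        \<le> (\<Sum>zs\<in>{zs\<in>?Y. 2 \<le> length zs}. K * (?n * (?w zs * (cmod (g zs))\<^sup>2)))"
      using mem w K(2) by (intro sum_mono mult_left_mono mult_right_mono) (auto simp: all_simplices_iff[OF S])
    also have "\<dots> \<le> (\<Sum>zs\<in>?Y. K * (?n * (?w zs * (cmod (g zs))\<^sup>2)))"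
      using w K(2) Y by (intro sum_mono2) auto
    finally show ?thesis .
  qed
  also have "\<dots> = ?n * K * (\<Sum>zs\<in>?Y. ?w zs * (cmod (g zs))\<^sup>2)"
    by (simp add: sum_distrib_left mult_ac)
  also have "(\<Sum>zs\<in>?Y. ?w zs * (cmod (g zs))\<^sup>2) = (l2_norm S g)\<^sup>2"
    by (rule l2_norm_finite[symmetric]) (use S g fin_cochains_l2 F in auto)
  also have "?n * K * (l2_norm S g)\<^sup>2 = (sqrt (?n * K) * l2_norm S g)\<^sup>2"
    using K(2) by (simp add: power_mult_distrib)
  finally show "(l2_norm S (delta_op S g))\<^sup>2 \<le> (sqrt (?n * K) * l2_norm S g)\<^sup>2" .
  show "0 \<le> sqrt (?n * K) * l2_norm S g"
    by (intro mult_nonneg_nonneg nrm_ge_0 fin_cochains_l2 g) (use K(2) in simp)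
qed

text \<open>
  The bound for \<open>d\<close> follows from the one for \<open>\<delta>\<close>, since
  \<open>\<parallel>d f\<parallel>\<^sup>2 = \<langle>f, \<delta> (d f)\<rangle> \<le> \<parallel>f\<parallel> \<sqdot> C \<parallel>d f\<parallel>\<close>.
\<close>

lemma gauss_bonnet_bounded:
  assumes S: "is_weighted_complex S" and lf: "locally_finite_complex S"
    and bdd: "\<forall>i\<le>max_vertices S - 2. bdd_above (weighted_degree S ` simplices S i)"
  shows "\<exists>K\<ge>0. \<forall>f\<in>fin_cochains S. l2_norm S (gauss_bonnet S f) \<le> K * l2_norm S f"
proof -
  interpret complex_hilbert_space scale_cochain "l2_cochains S" "l2_inner S" "l2_norm S"
    by (rule complex_hilbert_space_l2_cochains[OF S])
  have "bdd_above (\<Union>i\<in>{..max_vertices S - 2}. weighted_degree S ` simplices S i)"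
    using bdd by (subst bdd_above_UN) auto
  then obtain K0 where "\<forall>t\<in>(\<Union>i\<in>{..max_vertices S - 2}. weighted_degree S ` simplices S i). t \<le> K0"
    unfolding bdd_above_def ..
  then have K0: "weighted_degree S xs \<le> K0" if "i \<le> max_vertices S - 2" "xs \<in> simplices S i" for i xs
    using that by (meson UN_I atMost_iff imageI)
  define C where "C = sqrt (real (max_vertices S) * max K0 0)"
  have \<delta>: "l2_norm S (delta_op S g) \<le> C * l2_norm S g" if "g \<in> fin_cochains S" for g
    unfolding C_def using K0 by (intro l2_norm_delta_op_le S lf that) (auto intro: le_max_iff_disj[THEN iffD2])
  have C: "0 \<le> C" by (simp add: C_def)
  have d: "l2_norm S (d_op S f) \<le> C * l2_norm S f" if f: "f \<in> fin_cochains S" for f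
  proof -
    note df = fin_cochains_ops(1)[OF S lf f]
    note \<delta>df = fin_cochains_ops(2)[OF S lf df]
    note H = fin_cochains_l2[OF f] fin_cochains_l2[OF df] fin_cochains_l2[OF \<delta>df]
    have "(l2_norm S (d_op S f))\<^sup>2 = Re (l2_inner S f (delta_op S (d_op S f)))"
      by (simp add: nrm_sq H d_delta_adjoint[OF S lf f df])
    also have "\<dots> \<le> l2_norm S f * l2_norm S (delta_op S (d_op S f))"
      using Cauchy_Schwarz[OF H(1,3)] complex_Re_le_cmod order_trans by blast
    also have "\<dots> \<le> l2_norm S f * (C * l2_norm S (d_op S f))"
      using \<delta>[OF df] H by (intro mult_left_mono) auto
    finally have "l2_norm S (d_op S f) * l2_norm S (d_op S f) \<le> (C * l2_norm S f) * l2_norm S (d_op S f)"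
      by (simp add: power2_eq_square mult_ac)
    moreover have "0 \<le> C * l2_norm S f" using C H by simp
    ultimately show ?thesis
      using nrm_ge_0[OF H(2)] by (metis less_eq_real_def mult_right_le_imp_le)
  qed
  have "l2_norm S (gauss_bonnet S f) \<le> (2 * C) * l2_norm S f" if f: "f \<in> fin_cochains S" for f
  proof -
    have "gauss_bonnet S f = d_op S f + delta_op S f" by (simp add: gauss_bonnet_def plus_fun_def)
    then show ?thesis
      using nrm_triangle[of "d_op S f" "delta_op S f"] d[OF f] \<delta>[OF f]
        fin_cochains_ops(1,2)[OF S lf f] fin_cochains_l2 by fastforce
  qed
  then show ?thesis using C by (intro exI[of _ "2 * C"]) auto
qed

section \<open>Density of finitely supported cochains\<close>

text \<open>
  Cutting off to simplices over a finite set of vertices, rather than to an arbitrary finite set of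
  lists, keeps the function alternating.
\<close>

lemma truncation_in_fin_cochains:
  assumes S: "is_weighted_complex S" and y: "y \<in> cochains S" and F: "finite F"
  shows "(\<lambda>xs. if set xs \<subseteq> F then y xs else 0) \<in> fin_cochains S" (is "?t \<in> _")
proof -
  have swap: "y (us @ b # a # vs) = - y (us @ a # b # vs)" for us vs a b using y cochains_iff[OF S] by blast
  have "?t \<in> cochains S"
    unfolding cochains_iff[OF S]
  proof (intro conjI allI impI)
    show "?t xs = 0" if "xs \<notin> all_simplices S" for xs using y that by (simp add: cochain_zero)
    show "?t (us @ b # a # vs) = - ?t (us @ a # b # vs)" for us a b vs
      using swap[of us b a vs] by simp
  qed
  moreover have "finite {xs. ?t xs \<noteq> 0}"
    by (rule finite_subset[OF _ finite_simplices_over[OF S F]])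
      (use y cochain_zero in \<open>auto simp: simplices_over_def split: if_splits\<close>)
  ultimately show ?thesis by (simp add: fin_cochains_def)
qed

lemma truncation_approximates:
  assumes S: "is_weighted_complex S" and y: "y \<in> l2_cochains S" and "\<epsilon> > 0"
  shows "\<exists>F. finite F \<and> l2_norm S ((\<lambda>xs. if set xs \<subseteq> F then y xs else 0) - y) < \<epsilon>"
proof -
  interpret complex_hilbert_space scale_cochain "l2_cochains S" "l2_inner S" "l2_norm S"
    by (rule complex_hilbert_space_l2_cochains[OF S])
  let ?X = "all_simplices S" and ?h = "\<lambda>xs. simplex_weight S xs * (cmod (y xs))\<^sup>2"
  have sum: "?h summable_on ?X" and yc: "y \<in> cochains S"
    using y by (auto simp: l2_cochains_iff sq_summable_def)
  have h0: "0 \<le> ?h xs" if "xs \<in> ?X" for xs using simplex_weight_pos[OF S that] by simp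
  obtain Z where Z: "finite Z" "Z \<subseteq> ?X" "dist (sum ?h Z) (infsum ?h ?X) \<le> \<epsilon>\<^sup>2 / 2"
    using infsum_finite_approximation[OF sum, of "\<epsilon>\<^sup>2 / 2"] \<open>\<epsilon> > 0\<close> by auto
  define F where "F = \<Union> (set ` Z)"
  have F: "finite F" using Z(1) by (simp add: F_def)
  let ?Y = "simplices_over S F" and ?t = "\<lambda>xs. if set xs \<subseteq> F then y xs else 0"
  have Y: "finite ?Y" by (rule finite_simplices_over[OF S F])
  have ZY: "Z \<subseteq> ?Y" "?Y \<subseteq> ?X" using Z(2) by (auto simp: simplices_over_def F_def)
  have t: "?t \<in> l2_cochains S" by (rule fin_cochains_l2[OF truncation_in_fin_cochains[OF S yc F]])
  have "(\<Sum>\<^sub>\<infinity>xs\<in>?X. simplex_weight S xs * (cmod ((?t - y) xs))\<^sup>2) = infsum ?h (?X - ?Y)"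
    by (rule infsum_cong_neutral) (auto simp: simplices_over_def)
  also have "\<dots> = infsum ?h ?X - sum ?h ?Y"
    using infsum_Diff[OF sum _ ZY(2)] Y by simp
  also have "\<dots> \<le> infsum ?h ?X - sum ?h Z"
    using sum_mono2[OF Y ZY(1), of ?h] h0 ZY(2) by force
  also have "\<dots> \<le> \<epsilon>\<^sup>2 / 2" using Z(3) unfolding dist_real_def by linarith
  also have "\<dots> < \<epsilon>\<^sup>2" using \<open>\<epsilon> > 0\<close> by simp
  finally have "l2_norm S (?t - y) < sqrt (\<epsilon>\<^sup>2)"
    unfolding l2_norm_eq[OF S H_closed(3)[OF t y]] by (rule real_sqrt_less_mono)
  then show ?thesis using F \<open>\<epsilon> > 0\<close> by auto
qed

lemma fin_cochains_dense:
  assumes S: "is_weighted_complex S" and y: "y \<in> l2_cochains S" and "\<epsilon> > 0"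
  shows "\<exists>u\<in>fin_cochains S. l2_norm S (y - u) < \<epsilon>"
proof -
  interpret complex_hilbert_space scale_cochain "l2_cochains S" "l2_inner S" "l2_norm S"
    by (rule complex_hilbert_space_l2_cochains[OF S])
  obtain F where F: "finite F" "l2_norm S ((\<lambda>xs. if set xs \<subseteq> F then y xs else 0) - y) < \<epsilon>"
    using truncation_approximates[OF assms] by blast
  have t: "(\<lambda>xs. if set xs \<subseteq> F then y xs else 0) \<in> fin_cochains S"
    using y by (intro truncation_in_fin_cochains[OF S _ F(1)]) (simp add: l2_cochains_iff)
  show ?thesis by (rule bexI[OF _ t]) (use F(2) nrm_diff_commute[OF y fin_cochains_l2[OF t]] in simp)
qed


section \<open>Essential self-adjointness in the space of cochains\<close>

lemma op_closure_operator_on: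
  "(u, v) \<in> op_closure S (operator_on A T) \<longleftrightarrow> u \<in> l2_cochains S \<and> v \<in> l2_cochains S \<and>
    (\<exists>p. (\<forall>k::nat. p k \<in> A) \<and> (\<lambda>k. l2_norm S (p k - u)) \<longlonglongrightarrow> 0 \<and> (\<lambda>k. l2_norm S (T (p k) - v)) \<longlonglongrightarrow> 0)"
proof -
  have "(\<forall>k. (p k, q k) \<in> operator_on A T) \<longleftrightarrow> (\<forall>k. p k \<in> A) \<and> q = (\<lambda>k. T (p k))" for p q :: "nat \<Rightarrow> _"
    by (auto simp: operator_on_def intro!: ext)
  then show ?thesis unfolding op_closure_def fun_diff_def by auto
qed

lemma essentially_self_adjointD:
  assumes S: "is_weighted_complex S" and esa: "essentially_self_adjoint S (operator_on A T)"
  shows "complex_hilbert_space.adjoint_in_closure (l2_cochains S) (l2_inner S) (l2_norm S) A T"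
proof -
  interpret complex_hilbert_space scale_cochain "l2_cochains S" "l2_inner S" "l2_norm S"
    by (rule complex_hilbert_space_l2_cochains[OF S])
  have adj: "op_adjoint S (op_closure S (operator_on A T)) = op_closure S (operator_on A T)"
    and sub: "u \<in> A \<Longrightarrow> u \<in> l2_cochains S \<and> T u \<in> l2_cochains S" for u
    using esa unfolding essentially_self_adjoint_def self_adjoint_def symmetric_op_def operator_on_def by auto
  show ?thesis
    unfolding adjoint_in_closure_def
  proof (intro ballI impI)
    fix g h assume g: "g \<in> l2_cochains S" and h: "h \<in> l2_cochains S"
      and gh: "\<forall>u\<in>A. l2_inner S g (T u) = l2_inner S h u"
    have "l2_inner S g v = l2_inner S h u" if "(u, v) \<in> op_closure S (operator_on A T)" for u v
    proof -
      obtain p where uv: "u \<in> l2_cochains S" "v \<in> l2_cochains S" and p: "\<And>k. p k \<in> A"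
        "(\<lambda>k. l2_norm S (p k - u)) \<longlonglongrightarrow> 0" "(\<lambda>k. l2_norm S (T (p k) - v)) \<longlonglongrightarrow> 0"
        using \<open>(u, v) \<in> op_closure S (operator_on A T)\<close> unfolding op_closure_operator_on by blast
      have "(\<lambda>k. l2_inner S g (T (p k))) \<longlonglongrightarrow> l2_inner S g v" "(\<lambda>k. l2_inner S h (p k)) \<longlonglongrightarrow> l2_inner S h u"
        using sub[OF p(1)] g h uv p(2,3) by (auto intro!: ip_tendsto)
      moreover have "(\<lambda>k. l2_inner S g (T (p k))) = (\<lambda>k. l2_inner S h (p k))" using gh p(1) by auto
      ultimately show ?thesis by (metis LIMSEQ_unique)
    qed
    then have "(g, h) \<in> op_adjoint S (op_closure S (operator_on A T))"
      using g h unfolding op_adjoint_def by auto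
    then show "\<exists>p. (\<forall>k::nat. p k \<in> A) \<and> (\<lambda>k. l2_norm S (p k - g)) \<longlonglongrightarrow> 0 \<and> (\<lambda>k. l2_norm S (T (p k) - h)) \<longlonglongrightarrow> 0"
      unfolding adj op_closure_operator_on by blast
  qed
qed

lemma essentially_self_adjointI:
  assumes S: "is_weighted_complex S"
    and sym: "complex_hilbert_space.symmetric_operator scale_cochain (l2_cochains S) (l2_inner S) (fin_cochains S) T"
    and adj: "complex_hilbert_space.adjoint_in_closure (l2_cochains S) (l2_inner S) (l2_norm S) (fin_cochains S) T"
  shows "essentially_self_adjoint S (operator_on (fin_cochains S) T)"
proof -
  interpret complex_hilbert_space scale_cochain "l2_cochains S" "l2_inner S" "l2_norm S"
    by (rule complex_hilbert_space_l2_cochains[OF S])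
  let ?A = "fin_cochains S" and ?G = "operator_on (fin_cochains S) T"
  have lin: "linear_operator ?A T" and symT: "\<And>u v. \<lbrakk>u \<in> ?A; v \<in> ?A\<rbrakk> \<Longrightarrow> l2_inner S (T u) v = l2_inner S u (T v)"
    using sym by (auto simp: symmetric_operator_def)
  note TH = linear_operatorD(3)[OF lin] and AH = fin_cochains_l2[where S = S]
  have sub: "?G \<subseteq> op_closure S ?G"
  proof clarify
    fix u v assume "(u, v) \<in> ?G"
    then have uv: "u \<in> ?A" "v = T u" by (auto simp: operator_on_def)
    show "(u, v) \<in> op_closure S ?G"
      unfolding op_closure_operator_on by (intro conjI exI[of _ "\<lambda>_. u"]) (use uv TH AH in auto)
  qed
  have dense: "densely_defined S G" if "?G \<subseteq> G" for G
    unfolding densely_defined_def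
  proof (intro ballI allI impI)
    fix g \<epsilon> assume "g \<in> l2_cochains S" "(0::real) < \<epsilon>"
    then obtain u where "u \<in> ?A" "l2_norm S (g - u) < \<epsilon>" using fin_cochains_dense[OF S] by blast
    then show "\<exists>u\<in>Domain G. l2_norm S (\<lambda>xs. g xs - u xs) < \<epsilon>"
      using that unfolding fun_diff_def operator_on_def by blast
  qed
  have "symmetric_op S ?G"
    unfolding symmetric_op_def using dense[of ?G] TH AH symT by (auto simp: operator_on_def)
  moreover have "op_adjoint S (op_closure S ?G) = op_closure S ?G"
  proof (intro equalityI subrelI)
    fix g h assume "(g, h) \<in> op_adjoint S (op_closure S ?G)"
    then have gh: "g \<in> l2_cochains S" "h \<in> l2_cochains S"
      and *: "\<And>u v. (u, v) \<in> op_closure S ?G \<Longrightarrow> l2_inner S g v = l2_inner S h u"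
      by (auto simp: op_adjoint_def)
    have "\<forall>u\<in>?A. l2_inner S g (T u) = l2_inner S h u" using * sub by (auto simp: operator_on_def)
    then show "(g, h) \<in> op_closure S ?G"
      using adj gh unfolding adjoint_in_closure_def op_closure_operator_on by blast
  next
    fix u v assume uv: "(u, v) \<in> op_closure S ?G"
    then obtain p where H: "u \<in> l2_cochains S" "v \<in> l2_cochains S" and p: "\<And>k. p k \<in> ?A"
        "(\<lambda>k. l2_norm S (p k - u)) \<longlonglongrightarrow> 0" "(\<lambda>k. l2_norm S (T (p k) - v)) \<longlonglongrightarrow> 0"
      unfolding op_closure_operator_on by blast
    have "l2_inner S u v' = l2_inner S v u'" if uv': "(u', v') \<in> op_closure S ?G" for u' v'
    proof -
      obtain p' where H': "u' \<in> l2_cochains S" "v' \<in> l2_cochains S" and p': "\<And>k. p' k \<in> ?A"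
        "(\<lambda>k. l2_norm S (p' k - u')) \<longlonglongrightarrow> 0" "(\<lambda>k. l2_norm S (T (p' k) - v')) \<longlonglongrightarrow> 0"
        using uv' unfolding op_closure_operator_on by blast
      have "(\<lambda>k. l2_inner S (p k) (T (p' k))) \<longlonglongrightarrow> l2_inner S u v'"
        by (rule ip_tendsto) (use p p' H H' TH AH in auto)
      moreover have "(\<lambda>k. l2_inner S (T (p k)) (p' k)) \<longlonglongrightarrow> l2_inner S v u'"
        by (rule ip_tendsto) (use p p' H H' TH AH in auto)
      moreover have "(\<lambda>k. l2_inner S (p k) (T (p' k))) = (\<lambda>k. l2_inner S (T (p k)) (p' k))"
        using symT p(1) p'(1) by simp
      ultimately show ?thesis by (metis LIMSEQ_unique)
    qed
    then show "(u, v) \<in> op_adjoint S (op_closure S ?G)" using H by (auto simp: op_adjoint_def)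
  qed
  ultimately show ?thesis
    using dense[OF sub] by (simp add: essentially_self_adjoint_def self_adjoint_def)
qed

text \<open>
  A densely defined symmetric operator is closable, so on its domain the closure has only the value
  that the operator has: a second value would differ from it by a vector orthogonal to the domain.
\<close>

lemma op_apply_op_closure:
  assumes S: "is_weighted_complex S" and u: "u \<in> fin_cochains S"
    and sym: "complex_hilbert_space.symmetric_operator scale_cochain (l2_cochains S) (l2_inner S) (fin_cochains S) T"
  shows "op_apply (op_closure S (operator_on (fin_cochains S) T)) u = T u"
  unfolding op_apply_def
proof (rule the_equality)
  interpret complex_hilbert_space scale_cochain "l2_cochains S" "l2_inner S" "l2_norm S"
    by (rule complex_hilbert_space_l2_cochains[OF S])
  let ?A = "fin_cochains S" and ?G = "operator_on (fin_cochains S) T"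
  have lin: "linear_operator ?A T" and symT: "\<And>u v. \<lbrakk>u \<in> ?A; v \<in> ?A\<rbrakk> \<Longrightarrow> l2_inner S (T u) v = l2_inner S u (T v)"
    using sym by (auto simp: symmetric_operator_def)
  note TH = linear_operatorD(3)[OF lin] and AH = fin_cochains_l2[where S = S]
  show "(u, T u) \<in> op_closure S ?G"
    unfolding op_closure_operator_on by (intro conjI exI[of _ "\<lambda>_. u"]) (use u TH AH in auto)
  fix v assume "(u, v) \<in> op_closure S ?G"
  then obtain p where v: "v \<in> l2_cochains S" and p: "\<And>k. p k \<in> ?A"
      "(\<lambda>k. l2_norm S (p k - u)) \<longlonglongrightarrow> 0" "(\<lambda>k. l2_norm S (T (p k) - v)) \<longlonglongrightarrow> 0"
    unfolding op_closure_operator_on by blast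
  let ?r = "v - T u"
  have r: "?r \<in> l2_cochains S" using v TH[OF u] by simp
  have orth: "l2_inner S ?r w = 0" if w: "w \<in> ?A" for w
  proof -
    have "(\<lambda>k. l2_inner S (T (p k)) w) \<longlonglongrightarrow> l2_inner S v w"
      by (rule ip_tendsto) (use p w v TH AH in auto)
    moreover have "(\<lambda>k. l2_inner S (p k) (T w)) \<longlonglongrightarrow> l2_inner S u (T w)"
      by (rule ip_tendsto) (use p w u TH AH in auto)
    moreover have "(\<lambda>k. l2_inner S (T (p k)) w) = (\<lambda>k. l2_inner S (p k) (T w))"
      using symT p(1) w by simp
    ultimately have "l2_inner S v w = l2_inner S (T u) w"
      using symT[OF u w] by (metis LIMSEQ_unique)
    then show ?thesis using v TH[OF u] AH[OF w] by (simp add: ip_linear)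
  qed
  have "?r = 0"
  proof (rule ccontr)
    assume "?r \<noteq> 0"
    then have "0 < l2_norm S ?r" using nrm_eq_0D[OF r] nrm_ge_0[OF r] by (metis less_eq_real_def)
    then obtain w where w: "w \<in> ?A" "l2_norm S (?r - w) < l2_norm S ?r"
      using fin_cochains_dense[OF S r] by blast
    have "(l2_norm S (?r - w))\<^sup>2 = (l2_norm S ?r)\<^sup>2 + (l2_norm S w)\<^sup>2"
      using nrm_diff_sq[OF r AH[OF w(1)]] orth[OF w(1)] by simp
    moreover have "(l2_norm S (?r - w))\<^sup>2 < (l2_norm S ?r)\<^sup>2"
      using w r AH by (intro power_strict_mono) auto
    ultimately show False by (metis add_le_same_cancel1 linorder_not_le less_imp_le zero_le_power2 add_increasing2 order_refl)
  qed
  then show "v = T u" by simp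
qed


section \<open>Restriction to a set of vertices\<close>

lemma restrict_complex_simps [simp]:
  "vertices (restrict_complex S A) = A"
  "max_vertices (restrict_complex S A) = max_vertices S"
  "weight (restrict_complex S A) = weight S"
  "simplex_weight (restrict_complex S A) = simplex_weight S"
  by (auto simp: restrict_complex_def simplex_weight_def fun_eq_iff)

lemma adjacent_restrict:
  "A \<subseteq> vertices S \<Longrightarrow> adjacent (restrict_complex S A) x y \<longleftrightarrow> x \<in> A \<and> y \<in> A \<and> adjacent S x y"
  by (auto simp: adjacent_def)

lemma simplices_restrict:
  assumes "A \<subseteq> vertices S"
  shows "simplices (restrict_complex S A) i = {xs \<in> simplices S i. set xs \<subseteq> A}"
  using assms unfolding simplices_def adjacent_restrict[OF assms]
  by (auto simp: subset_iff)

lemma all_simplices_restrict: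
  "A \<subseteq> vertices S \<Longrightarrow> all_simplices (restrict_complex S A) = simplices_over S A"
  by (auto simp: all_simplices_def simplices_over_def simplices_restrict)

lemma is_weighted_complex_restrict:
  assumes S: "is_weighted_complex S" and A: "A \<subseteq> vertices S"
  shows "is_weighted_complex (restrict_complex S A)"
  unfolding is_weighted_complex_def restrict_complex_simps simplices_restrict[OF A]
proof (intro conjI ballI allI impI)
  show "countable A" "2 \<le> max_vertices S" using S A by (auto simp: is_weighted_complex_def intro: countable_subset)
  show "0 < weight S [x]" "weight S [x, x] = 0" if "x \<in> A" for x
    using S A that by (auto simp: is_weighted_complex_def)
  fix i xs assume i: "i < max_vertices S" and xs: "length xs = i + 1 \<and> set xs \<subseteq> A"
  then have "length xs = i + 1 \<and> set xs \<subseteq> vertices S" using A by auto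
  then have "weight S xs \<ge> 0 \<and> (weight S xs > 0 \<longleftrightarrow> xs \<in> simplices S i) \<and>
      (\<forall>p. p permutes {..<length xs} \<longrightarrow> weight S (permute_list p xs) = weight S xs)"
    using S i unfolding is_weighted_complex_def by simp
  then show "0 \<le> weight S xs" "(0 < weight S xs) = (xs \<in> {xs \<in> simplices S i. set xs \<subseteq> A})"
    "\<And>p. p permutes {..<length xs} \<Longrightarrow> weight S (permute_list p xs) = weight S xs"
    using xs by auto
qed

lemma locally_finite_restrict:
  assumes "locally_finite_complex S" "A \<subseteq> vertices S"
  shows "locally_finite_complex (restrict_complex S A)"
  unfolding locally_finite_complex_def
proof
  fix x assume "x \<in> vertices (restrict_complex S A)"
  then have "finite {y \<in> vertices S. adjacent S x y}"
    using assms by (auto simp: locally_finite_complex_def)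
  then show "finite {y \<in> vertices (restrict_complex S A). adjacent (restrict_complex S A) x y}"
    by (rule rev_finite_subset) (use assms(2) in \<open>auto simp: adjacent_restrict\<close>)
qed

lemma component_cochain:
  assumes S: "is_weighted_complex S" and A: "A \<subseteq> vertices S" and f: "f \<in> cochains S"
  shows "component (simplices_over S A) f \<in> cochains (restrict_complex S A)"
  unfolding cochains_iff[OF is_weighted_complex_restrict[OF S A]] all_simplices_restrict[OF A]
proof (intro conjI allI impI)
  fix us x y vs
  have "us @ y # x # vs \<in> simplices_over S A \<longleftrightarrow> us @ x # y # vs \<in> simplices_over S A"
    using all_simplices_mset_cong[OF S, of "us @ y # x # vs" "us @ x # y # vs"]
    by (auto simp: simplices_over_def)
  moreover have "f (us @ y # x # vs) = - f (us @ x # y # vs)" using f cochains_iff[OF S] by blast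
  ultimately show "component (simplices_over S A) f (us @ y # x # vs) = - component (simplices_over S A) f (us @ x # y # vs)"
    by (simp add: component_def)
qed (simp add: component_def)

lemma cochain_of_restrict:
  assumes S: "is_weighted_complex S" and A: "A \<subseteq> vertices S" and f: "f \<in> cochains (restrict_complex S A)"
  shows "f \<in> cochains S"
proof -
  have "\<forall>xs. xs \<notin> simplices_over S A \<longrightarrow> f xs = 0" "\<forall>us x y vs. f (us @ y # x # vs) = - f (us @ x # y # vs)"
    using f unfolding cochains_iff[OF is_weighted_complex_restrict[OF S A]] all_simplices_restrict[OF A] by blast+
  then show ?thesis unfolding cochains_iff[OF S] simplices_over_def by blast
qed

lemma component_of_restrict:
  assumes A: "A \<subseteq> vertices S" and f: "f \<in> cochains (restrict_complex S A)"
  shows "component (simplices_over S A) f = f"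
  using cochain_zero[OF f] by (auto simp: component_def fun_eq_iff all_simplices_restrict[OF A])

lemma component_fin_cochain:
  assumes "is_weighted_complex S" "A \<subseteq> vertices S" "f \<in> fin_cochains S"
  shows "component (simplices_over S A) f \<in> fin_cochains (restrict_complex S A)"
  using assms component_cochain[OF assms(1,2)] unfolding fin_cochains_def
  by (auto simp: component_def elim!: rev_finite_subset)

lemma fin_cochain_of_restrict:
  assumes "is_weighted_complex S" "A \<subseteq> vertices S" "f \<in> fin_cochains (restrict_complex S A)"
  shows "f \<in> fin_cochains S"
  using assms cochain_of_restrict[OF assms(1,2)] unfolding fin_cochains_def by auto

lemma component_l2_cochain:
  assumes S: "is_weighted_complex S" and A: "A \<subseteq> vertices S" and f: "f \<in> l2_cochains S"
  shows "component (simplices_over S A) f \<in> l2_cochains (restrict_complex S A)"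
proof -
  have "(\<lambda>xs. simplex_weight S xs * (cmod (f xs))\<^sup>2) summable_on simplices_over S A"
    using f unfolding l2_cochains_iff sq_summable_def
    by (auto intro: summable_on_subset_banach simp: simplices_over_def)
  then have "(\<lambda>xs. simplex_weight S xs * (cmod (component (simplices_over S A) f xs))\<^sup>2) summable_on simplices_over S A"
    by (rule summable_on_cong[THEN iffD1, rotated]) (simp add: component_def)
  then show ?thesis using f component_cochain[OF S A]
    by (simp add: l2_cochains_iff sq_summable_def all_simplices_restrict[OF A])
qed

lemma l2_cochain_of_restrict:
  assumes S: "is_weighted_complex S" and A: "A \<subseteq> vertices S" and f: "f \<in> l2_cochains (restrict_complex S A)"
  shows "f \<in> l2_cochains S"
proof -
  have "(\<lambda>xs. simplex_weight S xs * (cmod (f xs))\<^sup>2) summable_on simplices_over S A"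
    using f by (simp add: l2_cochains_iff sq_summable_def all_simplices_restrict[OF A])
  moreover have "f xs = 0" if "xs \<notin> simplices_over S A" for xs
    using f cochain_zero[of f "restrict_complex S A"] that by (auto simp: l2_cochains_iff all_simplices_restrict[OF A])
  ultimately have "(\<lambda>xs. simplex_weight S xs * (cmod (f xs))\<^sup>2) summable_on all_simplices S"
    by (subst summable_on_cong_neutral[of "simplices_over S A"]) (auto simp: simplices_over_def)
  then show ?thesis using f cochain_of_restrict[OF S A] by (simp add: l2_cochains_iff sq_summable_def)
qed

text \<open>
  Restricting the second argument to simplices over \<open>A\<close> is the orthogonal projection, so it is the
  adjoint of the inclusion of the cochains over \<open>A\<close>.
\<close>

lemma l2_inner_restrict:
  assumes S: "is_weighted_complex S" and A: "A \<subseteq> vertices S"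
    and f: "f \<in> l2_cochains (restrict_complex S A)" and g: "g \<in> l2_cochains S"
  shows "l2_inner S f g = l2_inner (restrict_complex S A) f (component (simplices_over S A) g)"
proof -
  have "f xs = 0" if "xs \<notin> simplices_over S A" for xs
    using f cochain_zero[of f "restrict_complex S A"] that by (auto simp: l2_cochains_iff all_simplices_restrict[OF A])
  then show ?thesis
    unfolding l2_inner_eq[OF S l2_cochain_of_restrict[OF S A f] g]
      l2_inner_eq[OF is_weighted_complex_restrict[OF S A] f component_l2_cochain[OF S A g]]
    by (intro infsum_cong_neutral) (auto simp: all_simplices_restrict[OF A] simplices_over_def component_def)
qed

lemma l2_norm_restrict:
  assumes "is_weighted_complex S" "A \<subseteq> vertices S" "f \<in> l2_cochains (restrict_complex S A)"
  shows "l2_norm (restrict_complex S A) f = l2_norm S f"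
  using l2_inner_restrict[OF assms l2_cochain_of_restrict[OF assms]] component_of_restrict[OF assms(2)] assms(3)
  by (simp add: l2_norm_def l2_cochains_iff)

lemma l2_norm_component_le:
  assumes S: "is_weighted_complex S" and A: "A \<subseteq> vertices S" and f: "f \<in> l2_cochains S"
  shows "l2_norm (restrict_complex S A) (component (simplices_over S A) f) \<le> l2_norm S f"
proof -
  interpret complex_hilbert_space scale_cochain "l2_cochains S" "l2_inner S" "l2_norm S"
    by (rule complex_hilbert_space_l2_cochains[OF S])
  interpret R: complex_hilbert_space scale_cochain "l2_cochains (restrict_complex S A)"
      "l2_inner (restrict_complex S A)" "l2_norm (restrict_complex S A)"
    by (rule complex_hilbert_space_l2_cochains[OF is_weighted_complex_restrict[OF S A]])
  let ?c = "component (simplices_over S A) f"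
  note c = component_l2_cochain[OF S A f]
  note cS = l2_cochain_of_restrict[OF S A c]
  have "(l2_norm S ?c)\<^sup>2 = Re (l2_inner S ?c f)"
    using R.nrm_sq[OF c] l2_inner_restrict[OF S A c f] l2_norm_restrict[OF S A c] by simp
  also have "\<dots> \<le> l2_norm S ?c * l2_norm S f"
    using Cauchy_Schwarz[OF cS f] complex_Re_le_cmod order_trans by blast
  finally have "l2_norm S ?c * l2_norm S ?c \<le> l2_norm S ?c * l2_norm S f" by (simp add: power2_eq_square)
  then have "l2_norm S ?c \<le> l2_norm S f"
    using nrm_ge_0[OF cS] nrm_ge_0[OF f] by (metis less_eq_real_def mult_left_le_imp_le)
  then show ?thesis by (simp add: l2_norm_restrict[OF S A c])
qed

text \<open>
  The Gauss--Bonnet operator of the restriction to \<open>A\<close>, extended by zero to the cochains on the other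
  simplices.
\<close>

definition compressed :: "'v weighted_complex \<Rightarrow> 'v set \<Rightarrow> 'v cochain \<Rightarrow> 'v cochain" where
  "compressed S A f = gauss_bonnet (restrict_complex S A) (component (simplices_over S A) f)"

lemma compressed_fin_cochain:
  assumes "is_weighted_complex S" "locally_finite_complex S" "A \<subseteq> vertices S" "f \<in> fin_cochains S"
  shows "compressed S A f \<in> fin_cochains (restrict_complex S A)"
  unfolding compressed_def
  by (intro fin_cochains_ops is_weighted_complex_restrict locally_finite_restrict component_fin_cochain assms)

lemma component_linear:
  "component B (f + g) = component B f + component B g"
  "component B (scale_cochain c f) = scale_cochain c (component B f)"
  by (auto simp: component_def fun_eq_iff)

lemma symmetric_compressed:
  assumes S: "is_weighted_complex S" and lf: "locally_finite_complex S" and A: "A \<subseteq> vertices S"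
  shows "complex_hilbert_space.symmetric_operator scale_cochain (l2_cochains S) (l2_inner S)
    (fin_cochains S) (compressed S A)"
proof -
  let ?R = "restrict_complex S A" and ?c = "component (simplices_over S A)"
  interpret complex_hilbert_space scale_cochain "l2_cochains S" "l2_inner S" "l2_norm S"
    by (rule complex_hilbert_space_l2_cochains[OF S])
  note SR = is_weighted_complex_restrict[OF S A] and lfR = locally_finite_restrict[OF lf A]
  interpret R: complex_hilbert_space scale_cochain "l2_cochains ?R" "l2_inner ?R" "l2_norm ?R"
    by (rule complex_hilbert_space_l2_cochains[OF SR])
  note cR = compressed_fin_cochain[OF S lf A, THEN fin_cochains_l2]
  have "compressed S A ` fin_cochains S \<subseteq> l2_cochains S"
    using cR l2_cochain_of_restrict[OF S A] by blast
  moreover have "fin_cochains S \<subseteq> l2_cochains S" using fin_cochains_l2 by blast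
  moreover have "subspace (fin_cochains S)" by (intro subspaceI fin_cochains_closed)
  ultimately have lin: "linear_operator (fin_cochains S) (compressed S A)"
    by (simp add: linear_operator_def compressed_def component_linear gauss_bonnet_linear)
  have "l2_inner S (compressed S A u) v = l2_inner S u (compressed S A v)"
    if u: "u \<in> fin_cochains S" and v: "v \<in> fin_cochains S" for u v
  proof -
    have "l2_inner S (compressed S A u) v = l2_inner ?R (compressed S A u) (?c v)"
      by (rule l2_inner_restrict[OF S A cR[OF u] fin_cochains_l2[OF v]])
    also have "\<dots> = l2_inner ?R (?c u) (compressed S A v)"
      using symmetric_gauss_bonnet[OF SR lfR] component_fin_cochain[OF S A] u v
      by (simp add: R.symmetric_operator_def compressed_def)
    also have "\<dots> = cnj (l2_inner ?R (compressed S A v) (?c u))"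
      by (rule R.ip_commute) (use u v cR component_fin_cochain[OF S A] fin_cochains_l2 in auto)
    also have "\<dots> = cnj (l2_inner S (compressed S A v) u)"
      by (simp add: l2_inner_restrict[OF S A cR[OF v] fin_cochains_l2[OF u]])
    also have "\<dots> = l2_inner S u (compressed S A v)"
      by (rule ip_commute[symmetric]) (use u v cR l2_cochain_of_restrict[OF S A] fin_cochains_l2 in auto)
    finally show ?thesis .
  qed
  then show ?thesis using lin by (simp add: symmetric_operator_def)
qed

text \<open>
  Split \<open>y\<close> into its part on simplices over \<open>A\<close> and the rest. The first part is approximated by the
  essential self-adjointness hypothesis. On the rest the operator is multiplication by \<open>i\<mu>\<close>, so
  dividing by \<open>i\<mu>\<close> and truncating suffices.
\<close>

lemma dense_range_shifted_compressed:
  assumes S: "is_weighted_complex S" and lf: "locally_finite_complex S" and A: "A \<subseteq> vertices S"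
    and esa: "essentially_self_adjoint (restrict_complex S A)
      (operator_on (fin_cochains (restrict_complex S A)) (gauss_bonnet (restrict_complex S A)))"
    and "\<mu> \<noteq> 0"
  shows "complex_hilbert_space.dense_range (l2_cochains S) (l2_norm S) (fin_cochains S)
    (\<lambda>u. compressed S A u + scale_cochain (\<i> * of_real \<mu>) u)"
proof -
  let ?R = "restrict_complex S A" and ?c = "component (simplices_over S A)"
  interpret complex_hilbert_space scale_cochain "l2_cochains S" "l2_inner S" "l2_norm S"
    by (rule complex_hilbert_space_l2_cochains[OF S])
  note SR = is_weighted_complex_restrict[OF S A] and lfR = locally_finite_restrict[OF lf A]
  interpret R: complex_hilbert_space scale_cochain "l2_cochains ?R" "l2_inner ?R" "l2_norm ?R"
    by (rule complex_hilbert_space_l2_cochains[OF SR])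
  have dense: "R.dense_range (fin_cochains ?R) (\<lambda>u. gauss_bonnet ?R u + scale_cochain (\<i> * of_real \<mu>) u)"
    by (rule R.dense_range_shifted[OF symmetric_gauss_bonnet[OF SR lfR] essentially_self_adjointD[OF SR esa] \<open>\<mu> \<noteq> 0\<close>])
  show ?thesis
    unfolding dense_range_def
  proof (intro ballI allI impI)
    fix y \<epsilon> assume y: "y \<in> l2_cochains S" and "\<epsilon> > (0::real)"
    let ?z = "\<i> * complex_of_real \<mu>"
    note cy = component_l2_cochain[OF S A y]
    note cyS = l2_cochain_of_restrict[OF S A cy]
    obtain u1 where u1: "u1 \<in> fin_cochains ?R"
        "l2_norm ?R (gauss_bonnet ?R u1 + scale_cochain ?z u1 - ?c y) < \<epsilon> / 2"
      using dense cy \<open>\<epsilon> > 0\<close> unfolding R.dense_range_def by (meson half_gt_zero)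
    define y' where "y' = scale_cochain (1 / ?z) (y - ?c y)"
    have y': "y' \<in> l2_cochains S" using y cyS by (simp add: y'_def)
    have zy': "scale_cochain ?z y' = y - ?c y" using \<open>\<mu> \<noteq> 0\<close> by (simp add: y'_def fun_eq_iff)
    obtain F where F: "finite F" "l2_norm S ((\<lambda>xs. if set xs \<subseteq> F then y' xs else 0) - y') < \<epsilon> / (2 * \<bar>\<mu>\<bar>)"
      using truncation_approximates[OF S y', of "\<epsilon> / (2 * \<bar>\<mu>\<bar>)"] \<open>\<epsilon> > 0\<close> \<open>\<mu> \<noteq> 0\<close> by auto
    define u2 where "u2 = (\<lambda>xs. if set xs \<subseteq> F then y' xs else 0)"
    have u2: "u2 \<in> fin_cochains S"
      unfolding u2_def using y' F(1) by (intro truncation_in_fin_cochains[OF S]) (auto simp: l2_cochains_iff)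
    have u1S: "u1 \<in> fin_cochains S" by (rule fin_cochain_of_restrict[OF S A u1(1)])
    have "?c u1 = u1" using u1(1) by (intro component_of_restrict[OF A]) (simp add: fin_cochains_def)
    moreover have "?c u2 = 0" by (auto simp: u2_def y'_def component_def fun_eq_iff)
    ultimately have "?c (u1 + u2) = u1" by (simp add: component_linear)
    then have comp: "compressed S A (u1 + u2) = gauss_bonnet ?R u1" by (simp add: compressed_def)
    let ?e1 = "gauss_bonnet ?R u1 + scale_cochain ?z u1 - ?c y" and ?e2 = "scale_cochain ?z (u2 - y')"
    have e1R: "?e1 \<in> l2_cochains ?R"
      using fin_cochains_ops(3)[OF SR lfR u1(1)] u1(1) cy by (simp add: fin_cochains_l2)
    have e1: "?e1 \<in> l2_cochains S" by (rule l2_cochain_of_restrict[OF S A e1R])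
    have d: "u2 - y' \<in> l2_cochains S" using u2 y' by (simp add: fin_cochains_l2)
    have "compressed S A (u1 + u2) + scale_cochain ?z (u1 + u2) - y = ?e1 + ?e2"
      unfolding comp scale_right_diff_distrib scale_right_distrib zy' by (simp add: algebra_simps)
    then have "l2_norm S (compressed S A (u1 + u2) + scale_cochain ?z (u1 + u2) - y) \<le> l2_norm S ?e1 + l2_norm S ?e2"
      using nrm_triangle[OF e1, of ?e2] d by simp
    also have "l2_norm S ?e1 < \<epsilon> / 2" using u1(2) l2_norm_restrict[OF S A e1R] by simp
    also have "l2_norm S ?e2 < \<epsilon> / 2"
    proof -
      have "l2_norm S ?e2 = \<bar>\<mu>\<bar> * l2_norm S (u2 - y')" using d by (simp add: norm_mult)
      also have "\<dots> < \<bar>\<mu>\<bar> * (\<epsilon> / (2 * \<bar>\<mu>\<bar>))"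
        using F(2) \<open>\<mu> \<noteq> 0\<close> unfolding u2_def by (intro mult_strict_left_mono) auto
      finally show ?thesis using \<open>\<mu> \<noteq> 0\<close> by simp
    qed
    finally have "l2_norm S (compressed S A (u1 + u2) + scale_cochain ?z (u1 + u2) - y) < \<epsilon>" by simp
    then show "\<exists>u\<in>fin_cochains S. l2_norm S (compressed S A u + scale_cochain ?z u - y) < \<epsilon>"
      using fin_cochains_closed(2)[OF u1S u2] by blast
  qed
qed

section \<open>Perturbation of the decoupled operator\<close>

lemma decoupled_eq:
  "decoupled S \<Lambda> f = compressed S \<Lambda> f + compressed S (vertices S - \<Lambda>) f"
  by (simp add: decoupled_def compressed_def fun_eq_iff interior_simplices_def exterior_simplices_def simplices_over_def)

theorem theorem4p16:
  fixes S :: "'v weighted_complex" and \<Lambda> :: "'v set"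
  assumes "is_weighted_complex S" and "locally_finite_complex S"
    and "\<Lambda> \<subseteq> vertices S" and "infinite \<Lambda>"
    and "chi_complete (restrict_complex S \<Lambda>)"
    and "\<forall>i\<le>max_vertices S - 2.
      bdd_above (weighted_degree (restrict_complex S \<Lambda>) ` simplices (restrict_complex S \<Lambda>) i)"
    and "locally_finite_complex (restrict_complex S (vertices S - \<Lambda>))"
    and "essentially_self_adjoint (restrict_complex S (vertices S - \<Lambda>))
      (operator_on (fin_cochains (restrict_complex S (vertices S - \<Lambda>)))
        (gauss_bonnet (restrict_complex S (vertices S - \<Lambda>))))"
    and "symmetric_op S (operator_on (fin_cochains S) (coupling S \<Lambda>))"
    and "\<exists>a b :: real. 0 \<le> a \<and> 0 \<le> b \<and> b < 1 \<and>
      (\<forall>u\<in>fin_cochains S.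
        l2_norm S (coupling S \<Lambda> u) \<le> a * l2_norm S u
          + b * l2_norm S (op_apply
              (op_closure S (operator_on (fin_cochains S) (decoupled S \<Lambda>))) u))"
  shows "essentially_self_adjoint S (operator_on (fin_cochains S) (gauss_bonnet S))"
proof -
  note S = assms(1) and lf = assms(2)
  interpret complex_hilbert_space scale_cochain "l2_cochains S" "l2_inner S" "l2_norm S"
    by (rule complex_hilbert_space_l2_cochains[OF S])
  let ?A = "fin_cochains S" and ?D = "gauss_bonnet S"
  let ?T_in = "compressed S \<Lambda>" and ?T_out = "compressed S (vertices S - \<Lambda>)"
  have ext: "vertices S - \<Lambda> \<subseteq> vertices S" by blast
  note sym_in = symmetric_compressed[OF S lf assms(3)] and sym_out = symmetric_compressed[OF S lf ext]
  note sym_D = symmetric_gauss_bonnet[OF S lf]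
  have H: "?T_in u \<in> l2_cochains S" "?T_out u \<in> l2_cochains S" "?D u \<in> l2_cochains S" "u \<in> l2_cochains S"
    if "u \<in> ?A" for u
    using that sym_in sym_out sym_D linear_operatorD(3) fin_cochains_l2 unfolding symmetric_operator_def by blast+
  have sym_0: "symmetric_operator ?A (decoupled S \<Lambda>)"
    unfolding decoupled_eq by (rule symmetric_operator_add[OF sym_in sym_out])
  obtain K where K: "0 \<le> K" "\<And>f. f \<in> fin_cochains (restrict_complex S \<Lambda>) \<Longrightarrow>
      l2_norm (restrict_complex S \<Lambda>) (gauss_bonnet (restrict_complex S \<Lambda>) f) \<le> K * l2_norm (restrict_complex S \<Lambda>) f"
    using gauss_bonnet_bounded[OF is_weighted_complex_restrict[OF S assms(3)] locally_finite_restrict[OF lf assms(3)]]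
      assms(6) by auto
  have T_in_le: "l2_norm S (?T_in u) \<le> K * l2_norm S u" if u: "u \<in> ?A" for u
  proof -
    let ?c = "component (simplices_over S \<Lambda>) u"
    have "l2_norm S (?T_in u) = l2_norm (restrict_complex S \<Lambda>) (?T_in u)"
      by (rule l2_norm_restrict[OF S assms(3) fin_cochains_l2[OF compressed_fin_cochain[OF S lf assms(3) u]], symmetric])
    also have "\<dots> \<le> K * l2_norm (restrict_complex S \<Lambda>) ?c"
      unfolding compressed_def by (rule K(2)[OF component_fin_cochain[OF S assms(3) u]])
    also have "\<dots> \<le> K * l2_norm S u"
      using l2_norm_component_le[OF S assms(3) H(4)[OF u]] K(1) by (rule mult_left_mono)
    finally show ?thesis .
  qed
  obtain a b where ab: "0 \<le> a" "0 \<le> b" "b < 1"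
    and V: "\<And>u. u \<in> ?A \<Longrightarrow> l2_norm S (coupling S \<Lambda> u) \<le> a * l2_norm S u + b * l2_norm S (decoupled S \<Lambda> u)"
    using assms(10) op_apply_op_closure[OF S _ sym_0] by auto
  have "adjoint_in_closure ?A ?D"
  proof (rule Kato_Rellich[OF sym_out _ sym_D])
    show "dense_range ?A (shifted ?T_out \<mu>)" if "\<mu> \<noteq> 0" for \<mu>
      by (rule dense_range_shifted_compressed[OF S lf ext assms(8) that])
    fix u assume u: "u \<in> ?A"
    have V_eq: "coupling S \<Lambda> u = ?D u - (?T_in u + ?T_out u)"
      by (simp add: coupling_def decoupled_eq fun_eq_iff)
    have "?D u - ?T_out u = coupling S \<Lambda> u + ?T_in u" unfolding V_eq by simp
    then have "l2_norm S (?D u - ?T_out u) \<le> l2_norm S (coupling S \<Lambda> u) + l2_norm S (?T_in u)"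
      using nrm_triangle[of "coupling S \<Lambda> u" "?T_in u"] H[OF u] V_eq by simp
    moreover have "b * l2_norm S (decoupled S \<Lambda> u) \<le> b * (K * l2_norm S u + l2_norm S (?T_out u))"
      using nrm_triangle[OF H(1)[OF u] H(2)[OF u]] T_in_le[OF u] ab(2)
      by (intro mult_left_mono) (auto simp: decoupled_eq)
    ultimately show "l2_norm S (?D u - ?T_out u) \<le> (a + K + b * K) * l2_norm S u + b * l2_norm S (?T_out u)"
      using V[OF u] T_in_le[OF u] by (simp add: algebra_simps)
  qed (use ab K(1) in auto)
  then show ?thesis by (rule essentially_self_adjointI[OF S sym_D])
qed

end
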